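(* Let $L\ge2$ and suppose that, as $\gamma\to\infty$, the transient durations $d_i=d_i(\gamma)\to\infty$ satisfy $d_i\sim c_i\frac{\log\gamma}{I_i}$ for constants $c_i\in[0,\infty]$, $1\le i\le L-1$, and set $c_L=\infty$. Let $h=\min\{1\le j\le L:\sum_{i=1}^{j}c_i\ge1\}$. Then, as $\gamma\to\infty$, $$\inf_{\tau\in\mathcal C_\gamma}J^{\boldsymbol d}_{\mathrm L}(\tau)\ \ge\ \inf_{\tau\in\mathcal C_\gamma}J^{\boldsymbol d}_{\mathrm P}(\tau)\ \ge\ \log\gamma\left(\sum_{i=1}^{h-1}\frac{c_i}{I_i}+\frac{1-\sum_{i=1}^{h-1}c_i}{I_h}\right)(1-o(1)).$$
   Context: Model. Let $L$ be a known integer and $f_0,f_1,\dots,f_L$ known probability densities with respect to a common measure. For each $1\le i\le L$ the Kullback-Leibler divergence $I_i=\int f_i\log\frac{f_i}{f_0}$ is assumed positive and finite. Independent random variables $X_1,X_2,\dots$ are observed sequentially, $\mathcal F_k=\sigma(X_1,\dots,X_k)$. For a change-point $v_1\ge1$ and a vector of transient durations $\boldsymbol d=(d_1,\dots,d_{L-1})$ of nonnegative integers, set $v_0=1$, $v_{i+1}=v_i+d_i$ for $1\le i\le L-1$, and $v_{L+1}=\infty$. Under $\mathbb{P}^{\boldsymbol d}_{v_1}$ (expectation $\mathbb{E}^{\boldsymbol d}_{v_1}$) the $X_k$ are independent with $X_k\sim f_i$ if $v_i\le k<v_{i+1}$, $0\le i\le L$. Under $\mathbb{P}_\infty$ (expectation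 $\mathbb{E}_\infty$) all $X_k$ are i.i.d. with density $f_0$. For $\gamma>1$, $\mathcal C_\gamma$ is the set of $\{\mathcal F_k\}$-stopping times $\tau$ with $\mathbb{E}_\infty[\tau]\ge\gamma$. Worst-case average detection delays: $J^{\boldsymbol d}_{\mathrm P}(\tau)=\sup_{v_1\ge1}\mathbb{E}^{\boldsymbol d}_{v_1}[\tau-v_1\mid\tau\ge v_1]$ (Pollak) and $J^{\boldsymbol d}_{\mathrm L}(\tau)=\sup_{v_1\ge1}\operatorname{ess\,sup}\mathbb{E}^{\boldsymbol d}_{v_1}[(\tau-v_1)^+\mid X_1,\dots,X_{v_1-1}]$ (Lorden). Convention: $d_i\sim c_i\log\gamma/I_i$ means $d_iI_i/\log\gamma\to c_i$ (with $c_i=0$ meaning $d_i=o(\log\gamma)$ and $c_i=\infty$ meaning $\log\gamma=o(d_i)$). *)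

theory Defs
  imports "HOL-Probability.Probability" "HOL-Probability.Essential_Supremum"
    "HOL-Probability.Stopping_Time" "HOL-Library.Landau_Symbols"
begin

text \<open>
  \<open>change_time L d v i\<close> is \<open>v\<^sub>i\<close>: \<open>v\<^sub>0 = 1\<close>, \<open>v\<^sub>1 = v\<close>, \<open>v\<^sub>i\<^sub>+\<^sub>1 = v\<^sub>i + d\<^sub>i\<close> for \<open>1 \<le> i \<le> L - 1\<close>, and
  \<open>v\<^sub>L\<^sub>+\<^sub>1 = \<infinity>\<close>.  Only the values \<open>d\<^sub>1, \<dots>, d\<^sub>L\<^sub>-\<^sub>1\<close> of the function \<open>d\<close> matter.
\<close>

primrec change_time :: "nat \<Rightarrow> (nat \<Rightarrow> nat) \<Rightarrow> nat \<Rightarrow> nat \<Rightarrow> enat" where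
  "change_time L d v 0 = 1"
| "change_time L d v (Suc i) =
     (if i = 0 then enat v
      else if i < L then change_time L d v i + enat (d i)
      else \<infinity>)"

text \<open>The library's \<open>KL_divergence b M N\<close> is the divergence of \<open>N\<close> from \<open>M\<close>, i.e.
  \<open>\<integral> log\<^sub>b (dN/dM) dN\<close>; see \<open>KL_info_eq\<close> below for the formula in terms of densities.\<close>

definition KL_info :: "'a measure \<Rightarrow> (nat \<Rightarrow> 'a \<Rightarrow> real) \<Rightarrow> nat \<Rightarrow> real" where
  "KL_info \<mu> f i = KL_divergence (exp 1) (density \<mu> (f 0)) (density \<mu> (f i))"

text \<open>
  \<open>P d v\<close> is the law with first change-point \<open>v\<close> and transient durations \<open>d\<close>, and \<open>Pinf\<close> the
  law without a change.  The underlying measurable space is arbitrary.  The observations are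
  \<open>X 1, X 2, \<dots>\<close>; \<open>X 0\<close> is irrelevant.  The Bochner integral in \<open>KL_divergence\<close> is \<open>0\<close> for
  a non-integrable integrand, so finiteness of the divergence is expressed by \<open>KL_ac\<close> and
  \<open>KL_integrable\<close>.
\<close>

locale transient_change_model =
  fixes L :: nat
    and \<mu> :: "'a measure"
    and f :: "nat \<Rightarrow> 'a \<Rightarrow> real"
    and X :: "nat \<Rightarrow> 'w \<Rightarrow> 'a"
    and Pinf :: "'w measure"
    and P :: "(nat \<Rightarrow> nat) \<Rightarrow> nat \<Rightarrow> 'w measure"
  assumes density_measurable: "\<And>i. i \<le> L \<Longrightarrow> f i \<in> borel_measurable \<mu>"
    and density_nonneg: "\<And>i x. i \<le> L \<Longrightarrow> x \<in> space \<mu> \<Longrightarrow> 0 \<le> f i x"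
    and density_prob: "\<And>i. i \<le> L \<Longrightarrow> prob_space (density \<mu> (f i))"
    and KL_ac: "\<And>i. 1 \<le> i \<Longrightarrow> i \<le> L \<Longrightarrow>
          absolutely_continuous (density \<mu> (f 0)) (density \<mu> (f i))"
    and KL_integrable: "\<And>i. 1 \<le> i \<Longrightarrow> i \<le> L \<Longrightarrow>
          integrable (density \<mu> (f i))
            (entropy_density (exp 1) (density \<mu> (f 0)) (density \<mu> (f i)))"
    and KL_pos: "\<And>i. 1 \<le> i \<Longrightarrow> i \<le> L \<Longrightarrow> 0 < KL_info \<mu> f i"
    and prob_Pinf: "prob_space Pinf"
    and indep_Pinf: "prob_space.indep_vars Pinf (\<lambda>_. \<mu>) X {1..}"
    and distributed_Pinf: "\<And>k. 1 \<le> k \<Longrightarrow> distributed Pinf \<mu> (X k) (f 0)"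
    and prob_P: "\<And>d v. 1 \<le> v \<Longrightarrow> prob_space (P d v)"
    and sets_P: "\<And>d v. 1 \<le> v \<Longrightarrow> sets (P d v) = sets Pinf"
    and indep_P: "\<And>d v. 1 \<le> v \<Longrightarrow> prob_space.indep_vars (P d v) (\<lambda>_. \<mu>) X {1..}"
    and distributed_P: "\<And>d v i k. 1 \<le> v \<Longrightarrow> i \<le> L \<Longrightarrow> 1 \<le> k \<Longrightarrow>
          change_time L d v i \<le> enat k \<Longrightarrow> enat k < change_time L d v (Suc i) \<Longrightarrow>
          distributed (P d v) \<mu> (X k) (f i)"

lemma (in transient_change_model) KL_info_eq:
  assumes i: "1 \<le> i" "i \<le> L"
  shows "KL_info \<mu> f i = (\<integral>x. f i x * ln (f i x / f 0 x) \<partial>\<mu>)"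
proof -
  have m [measurable]: "f 0 \<in> borel_measurable \<mu>" "f i \<in> borel_measurable \<mu>"
    using density_measurable i by auto
  have nn: "AE x in \<mu>. 0 \<le> f 0 x" "AE x in \<mu>. 0 \<le> f i x"
    using density_nonneg i by auto
  interpret P0: prob_space "density \<mu> (f 0)" using density_prob by simp
  have "emeasure (density \<mu> (f 0)) {x\<in>space \<mu>. f 0 x = 0} = 0"
    by (subst emeasure_density) (auto simp: nn_integral_0_iff_AE indicator_def)
  then have "{x\<in>space \<mu>. f 0 x = 0} \<in> null_sets (density \<mu> (f 0))" by (auto intro: null_setsI)
  then have "{x\<in>space \<mu>. f 0 x = 0} \<in> null_sets (density \<mu> (f i))"
    using KL_ac[OF i] by (auto simp: absolutely_continuous_def)
  then have "AE x in density \<mu> (f i). f 0 x \<noteq> 0" by (auto dest!: AE_not_in)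
  then have ac: "AE x in \<mu>. f 0 x = 0 \<longrightarrow> f i x = 0"
    using nn by (auto simp: AE_density)
  have eq: "density \<mu> (f i) = density (density \<mu> (f 0)) (\<lambda>x. f i x / f 0 x)"
    using nn ac by (subst density_density_divide) simp_all
  have "KL_info \<mu> f i = (\<integral>x. (f i x / f 0 x) * log (exp 1) (f i x / f 0 x) \<partial>density \<mu> (f 0))"
    unfolding KL_info_def eq using nn
    by (intro P0.KL_density) (auto simp: AE_density)
  also have "\<dots> = (\<integral>x. f i x * ln (f i x / f 0 x) \<partial>\<mu>)"
    using nn ac by (subst integral_density) (auto intro!: integral_cong_AE simp: log_def)
  finally show ?thesis .
qed

text \<open>
  \<open>obs_filtration \<mu> \<Omega> X (enat k)\<close> is \<open>\<F>\<^sub>k = \<sigma>(X\<^sub>1, \<dots>, X\<^sub>k)\<close>, trivial for \<open>k = 0\<close>; only \<open>space \<Omega>\<close>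
  is used.  Times are in \<^typ>\<open>enat\<close> because a stopping time may be infinite; the condition of
  \<open>stopping_time\<close> at the time \<open>\<infinity>\<close> is vacuous.
\<close>

definition obs_filtration :: "'a measure \<Rightarrow> 'w measure \<Rightarrow> (nat \<Rightarrow> 'w \<Rightarrow> 'a) \<Rightarrow> enat \<Rightarrow> 'w measure"
where
  "obs_filtration \<mu> \<Omega> X t =
     sigma (space \<Omega>) {X k -` A \<inter> space \<Omega> | k A. 1 \<le> k \<and> enat k \<le> t \<and> A \<in> sets \<mu>}"

definition stopping_class ::
  "'a measure \<Rightarrow> (nat \<Rightarrow> 'w \<Rightarrow> 'a) \<Rightarrow> 'w measure \<Rightarrow> real \<Rightarrow> ('w \<Rightarrow> enat) set" where
  "stopping_class \<mu> X Pinf \<gamma> =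
     {\<tau>. stopping_time (obs_filtration \<mu> Pinf X) \<tau> \<and>
         ennreal \<gamma> \<le> (\<integral>\<^sup>+\<omega>. ennreal_of_enat (\<tau> \<omega>) \<partial>Pinf)}"

text \<open>
  In the two delays, \<open>Pv v\<close> is the law with first change-point \<open>v\<close>.  Subtraction on \<^typ>\<open>enat\<close>
  truncates at \<open>0\<close> and satisfies \<open>\<infinity> - v = \<infinity>\<close>, so \<open>\<tau> - v\<close> is the positive part.  A \<open>v\<close> such that
  \<open>\<tau> \<ge> v\<close> has probability \<open>0\<close>, for which the conditional expectation is undefined, contributes \<open>0\<close>
  to Pollak's supremum, i.e. it is ignored.
\<close>

definition pollak_delay :: "(nat \<Rightarrow> 'w measure) \<Rightarrow> ('w \<Rightarrow> enat) \<Rightarrow> ennreal" where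
  "pollak_delay Pv \<tau> =
     (SUP v\<in>{1..}. \<integral>\<^sup>+\<omega>. ennreal_of_enat (\<tau> \<omega> - enat v)
        \<partial>uniform_measure (Pv v) {\<omega> \<in> space (Pv v). enat v \<le> \<tau> \<omega>})"

definition lorden_delay ::
  "'a measure \<Rightarrow> (nat \<Rightarrow> 'w \<Rightarrow> 'a) \<Rightarrow> (nat \<Rightarrow> 'w measure) \<Rightarrow> ('w \<Rightarrow> enat) \<Rightarrow> ennreal" where
  "lorden_delay \<mu> X Pv \<tau> =
     (SUP v\<in>{1..}. esssup (Pv v)
        (nn_cond_exp (Pv v) (obs_filtration \<mu> (Pv v) X (enat (v - 1)))
           (\<lambda>\<omega>. ennreal_of_enat (\<tau> \<omega> - enat v))))"

end

theory Submission
  imports Defs "HOL-Real_Asymp.Real_Asymp"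
begin

text \<open>
  The proof is Lai's change-of-measure argument.  If \<open>E\<^sub>\<infinity>[\<tau>] \<ge> \<gamma>\<close>, then for each window length \<open>m\<close>
  some \<open>v\<close> satisfies \<open>P\<^sub>\<infinity>(\<tau> < v + m | \<tau> \<ge> v) \<le> 2m/\<gamma>\<close>.  Let \<open>\<Lambda>\<close> be the log-likelihood ratio of
  \<open>P\<^sub>v\<close> against \<open>P\<^sub>\<infinity>\<close> over the whole window \<open>v \<le> k < v + m\<close>; it is independent of \<open>{\<tau> \<ge> v}\<close>
  under \<open>P\<^sub>v\<close>, whence \<open>P\<^sub>v(\<tau> < v + m | \<tau> \<ge> v) \<le> e\<^sup>b \<cdot> 2m/\<gamma> + P\<^sub>v(\<Lambda> > b)\<close> for every \<open>b\<close>.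
  Take \<open>m\<close> slightly below \<open>K log \<gamma>\<close>, where \<open>K\<close> is the constant of the theorem.  Such a window ends
  in the regime \<open>h\<close> or earlier, and \<open>K\<close> is exactly such that the mean of \<open>\<Lambda>\<close> stays below
  \<open>(1 - 2\<kappa>) log \<gamma>\<close> for some \<open>\<kappa> > 0\<close>.  With \<open>b = (1 - \<kappa>) log \<gamma>\<close> the first term is of order
  \<open>\<gamma>\<^sup>-\<^sup>\<kappa> log \<gamma>\<close>, and the second one is small by a weak law of large numbers that is uniform
  in \<open>v\<close>.  Hence the delay is at least about \<open>m\<close>.
\<close>

subsection \<open>A weak law of large numbers\<close>

text \<open>Induction on the index set: a new summand is independent of the sum of the others, so
  the cross term has mean zero. Integrability is carried along because the induction step needs it
  to split the integral.\<close>

lemma (in prob_space) indep_vars_centered_sum: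
  fixes Y :: "'i \<Rightarrow> 'a \<Rightarrow> real"
  assumes "finite I" "indep_vars (\<lambda>_. borel) Y I"
    and "\<And>i. i \<in> I \<Longrightarrow> integrable M (\<lambda>\<omega>. (Y i \<omega>)\<^sup>2)" "\<And>i. i \<in> I \<Longrightarrow> expectation (Y i) = 0"
  shows "integrable M (\<lambda>\<omega>. (\<Sum>i\<in>I. Y i \<omega>)\<^sup>2) \<and>
    expectation (\<lambda>\<omega>. (\<Sum>i\<in>I. Y i \<omega>)\<^sup>2) = (\<Sum>i\<in>I. expectation (\<lambda>\<omega>. (Y i \<omega>)\<^sup>2))"
  using assms
proof (induction I rule: finite_induct)
  case (insert i I)
  let ?S = "\<lambda>\<omega>. \<Sum>i\<in>I. Y i \<omega>"
  have rv [measurable]: "random_variable borel (Y j)" if "j \<in> insert i I" for j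
    using insert.prems(1) that by (auto simp: indep_vars_def)
  have int1: "integrable M (Y j)" if "j \<in> insert i I" for j
    using insert.prems(2)[OF that] rv[OF that] square_integrable_imp_integrable by blast
  have IH: "integrable M (\<lambda>\<omega>. (?S \<omega>)\<^sup>2)"
    "expectation (\<lambda>\<omega>. (?S \<omega>)\<^sup>2) = (\<Sum>i\<in>I. expectation (\<lambda>\<omega>. (Y i \<omega>)\<^sup>2))"
    using insert.IH insert.prems by (auto intro: indep_vars_subset)
  have indep: "indep_var borel (Y i) borel ?S"
    using insert by (intro indep_vars_sum) auto
  have intS: "integrable M ?S" using int1 by auto
  have ES: "expectation ?S = 0" using int1 insert.prems(3) by (subst Bochner_Integration.integral_sum) auto
  have cross: "integrable M (\<lambda>\<omega>. Y i \<omega> * ?S \<omega>)" "expectation (\<lambda>\<omega>. Y i \<omega> * ?S \<omega>) = 0"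
    using indep_var_integrable[OF indep] indep_var_lebesgue_integral[OF indep] int1 intS ES by auto
  have eq: "(\<Sum>i\<in>insert i I. Y i \<omega>)\<^sup>2 = (Y i \<omega>)\<^sup>2 + 2 * (Y i \<omega> * ?S \<omega>) + (?S \<omega>)\<^sup>2" for \<omega>
    using insert.hyps by (simp add: power2_sum)
  show ?case
    unfolding eq using insert.prems(2)[of i] insert.hyps IH cross by simp
qed simp

text \<open>The summands may have different laws, which enter the bound only through the truncation
  level \<open>B\<close> and the tail bound \<open>e\<close>. This is the source of uniformity in
  the change-point.\<close>

lemma (in prob_space) indep_vars_sum_deviation:
  fixes Z :: "'i \<Rightarrow> 'a \<Rightarrow> real" and B e t :: real
  assumes J: "finite J" and indep: "indep_vars (\<lambda>_. borel) Z J"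
    and int: "\<And>k. k \<in> J \<Longrightarrow> integrable M (Z k)"
    and tail: "\<And>k. k \<in> J \<Longrightarrow> expectation (\<lambda>\<omega>. if B < \<bar>Z k \<omega>\<bar> then \<bar>Z k \<omega>\<bar> else 0) \<le> e"
    and B: "0 \<le> B" and t: "0 < t"
  shows "prob {\<omega>\<in>space M. t \<le> (\<Sum>k\<in>J. Z k \<omega>) - (\<Sum>k\<in>J. expectation (Z k))}
    \<le> 4 * card J * B\<^sup>2 / t\<^sup>2 + 4 * card J * e / t"
proof -
  txt \<open>Only first moments are available: Chebyshev's inequality is applied to the truncations
    \<open>\<phi> (Z k)\<close> and Markov's inequality to the remainders.\<close>
  define \<phi> where "\<phi> x = (if B < \<bar>x\<bar> then 0 else x)" for x :: real
  have [measurable]: "\<phi> \<in> borel_measurable borel" unfolding \<phi>_def by measurable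
  have [measurable]: "random_variable borel (Z k)" if "k \<in> J" for k
    using int[OF that] by auto
  have \<phi>B: "\<bar>\<phi> x\<bar> \<le> B" for x using B by (auto simp: \<phi>_def)
  have int\<phi>: "integrable M (\<lambda>\<omega>. \<phi> (Z k \<omega>))" "integrable M (\<lambda>\<omega>. (\<phi> (Z k \<omega>))\<^sup>2)" if "k \<in> J" for k
  proof -
    show "integrable M (\<lambda>\<omega>. \<phi> (Z k \<omega>))"
      using that \<phi>B by (intro integrable_const_bound[where B=B]) auto
    show "integrable M (\<lambda>\<omega>. (\<phi> (Z k \<omega>))\<^sup>2)"
      using that \<phi>B by (intro integrable_const_bound[where B="B\<^sup>2"]) (auto simp: abs_le_square_iff[symmetric] B)
  qed
  define Y where "Y k \<omega> = \<phi> (Z k \<omega>) - expectation (\<lambda>\<omega>. \<phi> (Z k \<omega>))" for k \<omega>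
  define W where "W k \<omega> = Z k \<omega> - \<phi> (Z k \<omega>)" for k \<omega>
  have intY2: "integrable M (\<lambda>\<omega>. (Y k \<omega>)\<^sup>2)" if "k \<in> J" for k
    unfolding Y_def power2_diff using int\<phi>[OF that] by auto
  have EY: "expectation (Y k) = 0" if "k \<in> J" for k
    unfolding Y_def using int\<phi>[OF that] by (simp add: prob_space)
  have EY2: "expectation (\<lambda>\<omega>. (Y k \<omega>)\<^sup>2) \<le> B\<^sup>2" if "k \<in> J" for k
  proof -
    have "expectation (\<lambda>\<omega>. (Y k \<omega>)\<^sup>2) \<le> expectation (\<lambda>\<omega>. (\<phi> (Z k \<omega>))\<^sup>2)"
      unfolding Y_def using int\<phi>[OF that] by (subst variance_eq) auto
    also have "\<dots> \<le> expectation (\<lambda>\<omega>. B\<^sup>2)"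
      using int\<phi>[OF that] \<phi>B by (intro integral_mono) (auto simp: abs_le_square_iff[symmetric] B)
    finally show ?thesis by (simp add: prob_space)
  qed
  have indepY: "indep_vars (\<lambda>_. borel) Y J"
    unfolding Y_def by (rule indep_vars_compose2[OF indep, where Y="\<lambda>k x. \<phi> x - expectation (\<lambda>\<omega>. \<phi> (Z k \<omega>))"]) measurable
  have intW: "integrable M (W k)" if "k \<in> J" for k
    unfolding W_def using int int\<phi> that by auto
  have EZ: "expectation (Z k) = expectation (W k) + expectation (\<lambda>\<omega>. \<phi> (Z k \<omega>))" if "k \<in> J" for k
    unfolding W_def using int int\<phi> that by simp
  have EW: "expectation (\<lambda>\<omega>. \<bar>W k \<omega>\<bar>) \<le> e" if "k \<in> J" for k
  proof -
    have "\<bar>W k \<omega>\<bar> = (if B < \<bar>Z k \<omega>\<bar> then \<bar>Z k \<omega>\<bar> else 0)" for \<omega> by (auto simp: W_def \<phi>_def)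
    then show ?thesis using tail[OF that] by simp
  qed
  have [measurable]: "random_variable borel (Y k)" "random_variable borel (W k)" if "k \<in> J" for k
    using that unfolding Y_def W_def by measurable
  \<comment> \<open>Adding the mean of \<open>\<bar>W k \<omega>\<bar>\<close> makes
    \<open>?SW\<close> dominate the centred remainder while staying nonnegative, as Markov's
    inequality requires. Its mean is at most \<open>2 * e\<close> per index.\<close>
  let ?SY = "\<lambda>\<omega>. \<Sum>k\<in>J. Y k \<omega>" and ?SW = "\<lambda>\<omega>. \<Sum>k\<in>J. \<bar>W k \<omega>\<bar> + expectation (\<lambda>\<omega>. \<bar>W k \<omega>\<bar>)"
  have "prob {\<omega>\<in>space M. t/2 \<le> \<bar>?SY \<omega>\<bar>} \<le> expectation (\<lambda>\<omega>. (?SY \<omega>)\<^sup>2) / (t/2)\<^sup>2"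
    using indep_vars_centered_sum[OF J indepY intY2 EY] t by (intro second_moment_method) auto
  also have "\<dots> \<le> card J * B\<^sup>2 / (t/2)\<^sup>2"
    using indep_vars_centered_sum[OF J indepY intY2 EY] sum_bounded_above[of J, OF EY2] t
    by (intro divide_right_mono) auto
  finally have 1: "prob {\<omega>\<in>space M. t/2 \<le> \<bar>?SY \<omega>\<bar>} \<le> 4 * card J * B\<^sup>2 / t\<^sup>2"
    by (simp add: power_divide mult_ac)
  have "prob {\<omega>\<in>space M. t/2 \<le> ?SW \<omega>} \<le> expectation ?SW / (t/2)"
    using t intW by (intro integral_Markov_inequality_measure[where A="{}"]) (auto intro!: sum_nonneg)
  also have "expectation ?SW = (\<Sum>k\<in>J. 2 * expectation (\<lambda>\<omega>. \<bar>W k \<omega>\<bar>))"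
    using intW by (subst Bochner_Integration.integral_sum) (auto simp: prob_space)
  also have "\<dots> \<le> card J * (2 * e)"
    using EW by (intro sum_bounded_above) auto
  finally have 2: "prob {\<omega>\<in>space M. t/2 \<le> ?SW \<omega>} \<le> 4 * card J * e / t"
    using t by (simp add: divide_right_mono field_simps)
  have "{\<omega>\<in>space M. t \<le> (\<Sum>k\<in>J. Z k \<omega>) - (\<Sum>k\<in>J. expectation (Z k))} \<subseteq>
    {\<omega>\<in>space M. t/2 \<le> \<bar>?SY \<omega>\<bar>} \<union> {\<omega>\<in>space M. t/2 \<le> ?SW \<omega>}"
  proof safe
    fix \<omega> assume \<omega>: "\<omega> \<in> space M" "t \<le> (\<Sum>k\<in>J. Z k \<omega>) - (\<Sum>k\<in>J. expectation (Z k))" "\<not> t/2 \<le> ?SW \<omega>"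
    have "(\<Sum>k\<in>J. Z k \<omega>) - (\<Sum>k\<in>J. expectation (Z k)) = ?SY \<omega> + (\<Sum>k\<in>J. W k \<omega> - expectation (W k))"
      unfolding sum.distrib[symmetric] sum_subtractf[symmetric]
      using EZ by (intro sum.cong) (auto simp: Y_def W_def)
    also have "(\<Sum>k\<in>J. W k \<omega> - expectation (W k)) \<le> ?SW \<omega>"
    proof (intro sum_mono)
      fix k assume "k \<in> J"
      then have "- expectation (W k) \<le> expectation (\<lambda>\<omega>. \<bar>W k \<omega>\<bar>)"
        using integral_abs_bound[of M "W k"] by linarith
      then show "W k \<omega> - expectation (W k) \<le> \<bar>W k \<omega>\<bar> + expectation (\<lambda>\<omega>. \<bar>W k \<omega>\<bar>)" by linarith
    qed
    finally show "t/2 \<le> \<bar>?SY \<omega>\<bar>" using \<omega> by linarith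
  qed
  then have "prob {\<omega>\<in>space M. t \<le> (\<Sum>k\<in>J. Z k \<omega>) - (\<Sum>k\<in>J. expectation (Z k))} \<le>
    prob ({\<omega>\<in>space M. t/2 \<le> \<bar>?SY \<omega>\<bar>} \<union> {\<omega>\<in>space M. t/2 \<le> ?SW \<omega>})"
    by (intro finite_measure_mono) auto
  also have "\<dots> \<le> prob {\<omega>\<in>space M. t/2 \<le> \<bar>?SY \<omega>\<bar>} + prob {\<omega>\<in>space M. t/2 \<le> ?SW \<omega>}"
    by (intro measure_Un_le) auto
  finally show ?thesis using 1 2 by linarith
qed

text \<open>Dominated convergence along integer truncation levels, with majorant
  \<open>\<bar>g x\<bar>\<close>; at each point the integrand is eventually 0. It supplies the tail
  hypothesis of the deviation bound.\<close>

lemma integrable_tail_small: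
  fixes g :: "'a \<Rightarrow> real"
  assumes int: "integrable M g" and e: "0 < e"
  obtains B where "0 \<le> B" "(\<integral>x. (if B < \<bar>g x\<bar> then \<bar>g x\<bar> else 0) \<partial>M) \<le> e"
proof -
  have [measurable]: "g \<in> borel_measurable M" using int by auto
  have "(\<lambda>n. \<integral>x. (if real n < \<bar>g x\<bar> then \<bar>g x\<bar> else 0) \<partial>M) \<longlonglongrightarrow> (\<integral>x. 0 \<partial>M)"
  proof (rule integral_dominated_convergence[where w="\<lambda>x. \<bar>g x\<bar>"])
    show "AE x in M. (\<lambda>n. if real n < \<bar>g x\<bar> then \<bar>g x\<bar> else 0) \<longlonglongrightarrow> 0"
    proof (intro AE_I2 tendsto_eventually)
      fix x
      obtain N :: nat where "\<bar>g x\<bar> \<le> real N" using real_arch_simple by blast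
      then show "\<forall>\<^sub>F n in sequentially. (if real n < \<bar>g x\<bar> then \<bar>g x\<bar> else 0) = 0"
        by (intro eventually_sequentiallyI[of N]) (auto intro: order.trans)
    qed
  qed (use int in auto)
  then have "\<forall>\<^sub>F n in sequentially. (\<integral>x. (if real n < \<bar>g x\<bar> then \<bar>g x\<bar> else 0) \<partial>M) < e"
    using e by (intro order_tendstoD) auto
  then obtain n :: nat where "(\<integral>x. (if real n < \<bar>g x\<bar> then \<bar>g x\<bar> else 0) \<partial>M) < e"
    by (auto simp: eventually_sequentially)
  then show thesis using that[of "real n"] by simp
qed

subsection \<open>Densities on finite products\<close>

text \<open>Both sides are compared on boxes, which determine a measure on the finite product; there
  Tonelli's theorem factors the integral of the product density.\<close>

lemma PiM_density:
  fixes M :: "'i \<Rightarrow> 'a measure" and g :: "'i \<Rightarrow> 'a \<Rightarrow> ennreal"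
  assumes I: "finite I" and M: "\<And>i. sigma_finite_measure (M i)"
    and D: "\<And>i. sigma_finite_measure (density (M i) (g i))"
    and g: "\<And>i. i \<in> I \<Longrightarrow> g i \<in> borel_measurable (M i)"
  shows "PiM I (\<lambda>i. density (M i) (g i)) = density (PiM I M) (\<lambda>x. \<Prod>i\<in>I. g i (x i))"
proof -
  interpret M: product_sigma_finite M using M by (auto simp: product_sigma_finite_def)
  interpret D: product_sigma_finite "\<lambda>i. density (M i) (g i)" using D by (auto simp: product_sigma_finite_def)
  note g[measurable]
  show ?thesis
  proof (rule D.PiM_eqI[symmetric, OF I])
    show "sets (density (PiM I M) (\<lambda>x. \<Prod>i\<in>I. g i (x i))) = sets (PiM I (\<lambda>i. density (M i) (g i)))"
      by (simp cong: sets_PiM_cong)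
    fix A assume "\<And>i. i \<in> I \<Longrightarrow> A i \<in> sets (density (M i) (g i))"
    then have A [measurable]: "\<And>i. i \<in> I \<Longrightarrow> A i \<in> sets (M i)" by simp
    have PA: "Pi\<^sub>E I A \<in> sets (PiM I M)" using A I by (auto intro: sets_PiM_I_finite)
    have meas: "(\<lambda>x. \<Prod>i\<in>I. g i (x i)) \<in> borel_measurable (PiM I M)"
      by measurable
    have "emeasure (density (PiM I M) (\<lambda>x. \<Prod>i\<in>I. g i (x i))) (Pi\<^sub>E I A)
      = (\<integral>\<^sup>+x. (\<Prod>i\<in>I. g i (x i)) * indicator (Pi\<^sub>E I A) x \<partial>PiM I M)"
      using PA meas by (simp add: emeasure_density)
    also have "\<dots> = (\<integral>\<^sup>+x. (\<Prod>i\<in>I. g i (x i) * indicator (A i) (x i)) \<partial>PiM I M)"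
    proof (intro nn_integral_cong)
      fix x assume x: "x \<in> space (PiM I M)"
      have "indicator (Pi\<^sub>E I A) x = (\<Prod>i\<in>I. indicator (A i) (x i) :: ennreal)"
      proof (cases "x \<in> Pi\<^sub>E I A")
        case True then show ?thesis by (auto simp: PiE_iff intro!: prod.neutral[symmetric])
      next
        case False
        then obtain i where "i \<in> I" "x i \<notin> A i" using x by (auto simp: space_PiM PiE_iff)
        then show ?thesis using False I by (auto intro!: prod_zero[symmetric] bexI[of _ i])
      qed
      then show "(\<Prod>i\<in>I. g i (x i)) * indicator (Pi\<^sub>E I A) x = (\<Prod>i\<in>I. g i (x i) * indicator (A i) (x i))"
        by (simp add: prod.distrib)
    qed
    also have "\<dots> = (\<Prod>i\<in>I. \<integral>\<^sup>+x. g i x * indicator (A i) x \<partial>M i)"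
      using I by (intro M.product_nn_integral_prod) auto
    also have "\<dots> = (\<Prod>i\<in>I. emeasure (density (M i) (g i)) (A i))"
      by (intro prod.cong) (auto simp: emeasure_density)
    finally show "emeasure (density (PiM I M) (\<lambda>x. \<Prod>i\<in>I. g i (x i))) (Pi\<^sub>E I A)
      = (\<Prod>i\<in>I. emeasure (density (M i) (g i)) (A i))" .
  qed
qed

lemma (in prob_space) distr_restrict_eq_PiM:
  assumes I: "finite I" and indep: "indep_vars M' X I"
  shows "distr M (PiM I M') (\<lambda>\<omega>. \<lambda>i\<in>I. X i \<omega>) = PiM I (\<lambda>i. distr M (M' i) (X i))"
proof (cases "I = {}")
  \<comment> \<open>The empty family occurs for change-point 1, where there is no past. Both sides
    are then the point mass at the function that is \<open>undefined\<close> everywhere.\<close>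
  case True
  have undef: "(\<lambda>\<omega>. \<lambda>i\<in>{}. X i \<omega>) = (\<lambda>_ _. undefined)"
    by (auto simp: restrict_def)
  have "emeasure (distr M (PiM {} M') (\<lambda>\<omega>. \<lambda>i\<in>{}. X i \<omega>)) {\<lambda>_. undefined} = 1"
    unfolding undef by (subst emeasure_distr) (auto simp: PiM_empty emeasure_space_1)
  then show ?thesis
    unfolding True by (intro measure_eqI) (auto simp: sets_PiM_empty PiM_empty subset_singleton_iff)
next
  case False
  then show ?thesis
    using indep by (subst indep_vars_iff_distr_eq_PiM'[symmetric]) (auto simp: indep_vars_def)
qed

subsection \<open>Windows in which a late stopping time rarely stops\<close>

text \<open>A window of length \<open>m\<close> contains \<open>\<tau>\<close> for at most \<open>m\<close> starting points \<open>v\<close>, so the probabilities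
  on the left sum to at most \<open>m\<close>, whereas \<open>P(\<tau> \<ge> v)\<close> sums to \<open>E[\<tau>] \<ge> \<gamma>\<close>.\<close>

lemma (in prob_space) exists_low_hazard_window:
  fixes \<tau> :: "'a \<Rightarrow> enat"
  assumes \<tau> [measurable]: "\<tau> \<in> measurable M (count_space UNIV)"
    and mean: "ennreal \<gamma> \<le> (\<integral>\<^sup>+\<omega>. ennreal_of_enat (\<tau> \<omega>) \<partial>M)" and \<gamma>: "0 < \<gamma>" and m: "1 \<le> m"
  shows "\<exists>v\<ge>1. 0 < prob {\<omega>\<in>space M. enat v \<le> \<tau> \<omega>} \<and>
    prob {\<omega>\<in>space M. enat v \<le> \<tau> \<omega> \<and> \<tau> \<omega> < enat (v + m)}
      \<le> 2 * m / \<gamma> * prob {\<omega>\<in>space M. enat v \<le> \<tau> \<omega>}"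
proof (rule ccontr)
  let ?H = "\<lambda>v. {\<omega>\<in>space M. enat v \<le> \<tau> \<omega> \<and> \<tau> \<omega> < enat (v + m)}" and ?T = "\<lambda>v. {\<omega>\<in>space M. enat v \<le> \<tau> \<omega>}"
  assume neg: "\<not> ?thesis"
  \<comment> \<open>The negated claim concerns only \<open>v\<close> with
    \<open>prob (?T v) > 0\<close>; for the others the left side is 0, so the inequality can be
    summed over all \<open>v\<close>.\<close>
  have le: "2 * m / \<gamma> * prob (?T v) \<le> prob (?H v)" if "1 \<le> v" for v
  proof (cases "prob (?T v) = 0")
    case False
    then have "0 < prob (?T v)" by (simp add: zero_less_measure_iff)
    then show ?thesis using neg that by force
  qed simp
  \<comment> \<open>For \<open>\<tau> \<omega> = n\<close> the window starting at
    \<open>t + 1\<close> contains \<open>n\<close> iff \<open>n - m \<le> t < n\<close>; an infinite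
    \<open>\<tau> \<omega>\<close> lies in no window.\<close>
  have cnt: "(\<Sum>t. indicator (?H (Suc t)) \<omega>) \<le> ennreal m" if \<omega>: "\<omega> \<in> space M" for \<omega>
  proof (cases "\<tau> \<omega>")
    case (enat n)
    have "(\<Sum>t. indicator (?H (Suc t)) \<omega> :: ennreal) = (\<Sum>t\<in>{n-m..<n}. indicator (?H (Suc t)) \<omega>)"
      using enat by (intro suminf_finite) (auto simp: indicator_def)
    also have "\<dots> \<le> (\<Sum>t\<in>{n-m..<n}. 1)" by (intro sum_mono) (auto simp: indicator_def)
    also have "\<dots> \<le> ennreal m" by (auto simp: ennreal_of_nat_eq_real_of_nat)
    finally show ?thesis .
  qed simp
  \<comment> \<open>The chain ends in \<open>2 * m \<le> m\<close>, a contradiction thanks to the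
    factor 2. It runs in \<open>ennreal\<close> because the mean of \<open>\<tau>\<close> may be
    infinite.\<close>
  have "ennreal (2 * m) = ennreal (2 * m / \<gamma>) * ennreal \<gamma>"
    using \<gamma> by (simp add: ennreal_mult[symmetric])
  also have "\<dots> \<le> ennreal (2 * m / \<gamma>) * (\<integral>\<^sup>+\<omega>. ennreal_of_enat (\<tau> \<omega>) \<partial>M)"
    using mean by (intro mult_left_mono) auto
  also have "(\<integral>\<^sup>+\<omega>. ennreal_of_enat (\<tau> \<omega>) \<partial>M) = (\<Sum>t. emeasure M (?T (Suc t)))"
    by (simp add: nn_integral_enat_function Suc_ile_eq)
  also have "ennreal (2 * m / \<gamma>) * \<dots> = (\<Sum>t. ennreal (2 * m / \<gamma>) * emeasure M (?T (Suc t)))"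
    by simp
  also have "\<dots> \<le> (\<Sum>t. emeasure M (?H (Suc t)))"
    using le[of "Suc _"] \<gamma>
    by (intro suminf_le) (auto simp: emeasure_eq_measure ennreal_mult[symmetric] simp del: of_nat_Suc intro!: ennreal_leI)
  also have "\<dots> = (\<integral>\<^sup>+\<omega>. (\<Sum>t. indicator (?H (Suc t)) \<omega>) \<partial>M)"
    by (simp add: nn_integral_suminf)
  also have "\<dots> \<le> (\<integral>\<^sup>+\<omega>. ennreal m \<partial>M)"
    using cnt by (intro nn_integral_mono) auto
  also have "\<dots> = ennreal m" by (simp add: emeasure_space_1)
  finally show False using m by (simp add: ennreal_le_iff)
qed

subsection \<open>Regimes and observations\<close>

context transient_change_model
begin

text \<open>The index \<open>i\<close> of the density of observation \<open>k\<close>. Taking the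
  least one skips regimes that are empty because a duration is 0.\<close>

definition regime :: "(nat \<Rightarrow> nat) \<Rightarrow> nat \<Rightarrow> nat \<Rightarrow> nat" where
  "regime d v k = (LEAST i. enat k < change_time L d v (Suc i))"

lemma enat_less_change_time_regime:
  fixes d v k
  assumes "1 \<le> L"
  shows "regime d v k \<le> L" "enat k < change_time L d v (Suc (regime d v k))"
proof -
  have *: "enat k < change_time L d v (Suc L)" using assms by simp
  show "regime d v k \<le> L" unfolding regime_def by (rule Least_le) (rule *)
  show "enat k < change_time L d v (Suc (regime d v k))"
    unfolding regime_def by (rule LeastI) (rule *)
qed

lemma change_time_regime_le:
  assumes "1 \<le> k"
  shows "change_time L d v (regime d v k) \<le> enat k"
proof (cases "regime d v k")
  case 0
  then show ?thesis using assms by (simp add: one_enat_def)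
next
  case (Suc i)
  then have "i < regime d v k" by simp
  then have "\<not> enat k < change_time L d v (Suc i)" unfolding regime_def by (rule not_less_Least)
  then show ?thesis unfolding Suc by (simp only: not_less)
qed

lemma regime_eq_0_iff:
  assumes "1 \<le> L"
  shows "regime d v k = 0 \<longleftrightarrow> k < v"
proof
  assume "regime d v k = 0"
  then show "k < v" using enat_less_change_time_regime(2)[OF assms, where d=d and v=v and k=k] by simp
next
  assume "k < v"
  then have "enat k < change_time L d v (Suc 0)" by simp
  then show "regime d v k = 0" unfolding regime_def by (intro Least_eq_0)
qed

lemma regime_pos: "1 \<le> L \<Longrightarrow> v \<le> k \<Longrightarrow> 1 \<le> regime d v k"
  using regime_eq_0_iff[where d=d and v=v and k=k] by linarith

lemma distributed_regime:
  assumes "1 \<le> L" "1 \<le> v" "1 \<le> k"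
  shows "distributed (P d v) \<mu> (X k) (f (regime d v k))"
  using assms enat_less_change_time_regime[where d=d and v=v and k=k] change_time_regime_le[where d=d and v=v and k=k]
  by (intro distributed_P) auto

lemma space_P: "1 \<le> v \<Longrightarrow> space (P d v) = space Pinf"
  by (rule sets_eq_imp_space_eq) (rule sets_P)

lemma X_measurable: "1 \<le> k \<Longrightarrow> X k \<in> measurable Pinf \<mu>"
  using distributed_Pinf[of k] by (simp add: distributed_def)

lemma measurable_P_eq: "1 \<le> v \<Longrightarrow> measurable (P d v) N = measurable Pinf N"
  by (rule measurable_cong_sets) (auto simp: sets_P)

abbreviation obs :: "nat \<Rightarrow> 'w \<Rightarrow> nat \<Rightarrow> 'a" where
  "obs n \<omega> \<equiv> \<lambda>k\<in>{1..n}. X k \<omega>"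

lemma obs_measurable: "obs n \<in> measurable Pinf (PiM {1..n} (\<lambda>_. \<mu>))"
  by (intro measurable_restrict X_measurable) auto

text \<open>The generators of \<open>\<F>\<^sub>n\<close> are preimages under the observation
  vector, and such preimages form a sigma-algebra. Probabilities of events in
  \<open>\<F>\<^sub>n\<close> thus become values of the law of that vector.\<close>

lemma sets_obs_filtration:
  assumes A: "A \<in> sets (obs_filtration \<mu> Pinf X (enat n))"
  obtains C where "C \<in> sets (PiM {1..n} (\<lambda>_. \<mu>))" "A = obs n -` C \<inter> space Pinf"
proof -
  let ?V = "vimage_algebra (space Pinf) (obs n) (PiM {1..n} (\<lambda>_. \<mu>))"
  have sp: "obs n \<in> space Pinf \<rightarrow> space (PiM {1..n} (\<lambda>_. \<mu>))"
    using measurable_space[OF obs_measurable] by auto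
  have "sets (obs_filtration \<mu> Pinf X (enat n)) \<subseteq> sets ?V"
    unfolding obs_filtration_def
  proof (subst sets_measure_of)
    have "sigma_sets (space ?V) {X k -` A \<inter> space Pinf |k A. 1 \<le> k \<and> enat k \<le> enat n \<and> A \<in> sets \<mu>} \<subseteq> sets ?V"
    proof (intro sets.sigma_sets_subset subsetI)
      fix S assume "S \<in> {X k -` A \<inter> space Pinf |k A. 1 \<le> k \<and> enat k \<le> enat n \<and> A \<in> sets \<mu>}"
      then obtain k A where kA: "S = X k -` A \<inter> space Pinf" "1 \<le> k" "k \<le> n" "A \<in> sets \<mu>" by auto
      have C: "(\<lambda>x. x k) -` A \<inter> space (PiM {1..n} (\<lambda>_. \<mu>)) \<in> sets (PiM {1..n} (\<lambda>_. \<mu>))"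
        using kA by (intro measurable_sets[where A=\<mu>] measurable_component_singleton) auto
      have "S = obs n -` ((\<lambda>x. x k) -` A \<inter> space (PiM {1..n} (\<lambda>_. \<mu>))) \<inter> space Pinf"
        using kA sp by auto
      then show "S \<in> sets ?V" using in_vimage_algebra[OF C] by metis
    qed
    then show "sigma_sets (space Pinf) {X k -` A \<inter> space Pinf |k A. 1 \<le> k \<and> enat k \<le> enat n \<and> A \<in> sets \<mu>} \<subseteq> sets ?V"
      by simp
  qed auto
  then have "A \<in> sets ?V" using A by auto
  then show thesis using that sp by (auto simp: sets_vimage_algebra2)
qed

lemma sets_obs_filtration_subset: "A \<in> sets (obs_filtration \<mu> Pinf X (enat n)) \<Longrightarrow> A \<in> sets Pinf"
  using measurable_sets[OF obs_measurable] by (elim sets_obs_filtration) auto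

lemma obs_filtration_mono:
  "n \<le> m \<Longrightarrow> sets (obs_filtration \<mu> Pinf X (enat n)) \<subseteq> sets (obs_filtration \<mu> Pinf X (enat m))"
  unfolding obs_filtration_def
  by (subst (1 2) sets_measure_of) (auto intro!: sigma_sets_mono' dest: order_trans)

lemma distr_obs_Pinf: "distr Pinf (PiM {1..n} (\<lambda>_. \<mu>)) (obs n) = PiM {1..n} (\<lambda>_. density \<mu> (f 0))"
proof -
  interpret prob_space Pinf by (rule prob_Pinf)
  have "distr Pinf (PiM {1..n} (\<lambda>_. \<mu>)) (obs n) = PiM {1..n} (\<lambda>k. distr Pinf \<mu> (X k))"
    by (intro distr_restrict_eq_PiM indep_vars_subset[OF indep_Pinf]) auto
  also have "\<dots> = PiM {1..n} (\<lambda>_. density \<mu> (f 0))"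
    using distributed_Pinf by (intro PiM_cong) (auto simp: distributed_def)
  finally show ?thesis .
qed

lemma distr_obs_P:
  assumes "1 \<le> L" "1 \<le> v"
  shows "distr (P d v) (PiM {1..n} (\<lambda>_. \<mu>)) (obs n) = PiM {1..n} (\<lambda>k. density \<mu> (f (regime d v k)))"
proof -
  interpret prob_space "P d v" using assms by (intro prob_P)
  have "distr (P d v) (PiM {1..n} (\<lambda>_. \<mu>)) (obs n) = PiM {1..n} (\<lambda>k. distr (P d v) \<mu> (X k))"
    using assms by (intro distr_restrict_eq_PiM indep_vars_subset[OF indep_P]) auto
  also have "\<dots> = PiM {1..n} (\<lambda>k. density \<mu> (f (regime d v k)))"
    using distributed_regime assms by (intro PiM_cong) (auto simp: distributed_def)
  finally show ?thesis .
qed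

text \<open>Every observation before \<open>v\<close> is in regime 0, so the vector of the first
  \<open>v - 1\<close> observations has the same law under both measures.\<close>

lemma P_eq_Pinf_before_change:
  assumes "1 \<le> L" "1 \<le> v" "A \<in> sets (obs_filtration \<mu> Pinf X (enat (v - 1)))"
  shows "emeasure (P d v) A = emeasure Pinf A"
proof -
  obtain C where C: "C \<in> sets (PiM {1..v - 1} (\<lambda>_. \<mu>))" "A = obs (v - 1) -` C \<inter> space Pinf"
    using assms(3) by (rule sets_obs_filtration)
  have "emeasure (P d v) A = emeasure (distr (P d v) (PiM {1..v - 1} (\<lambda>_. \<mu>)) (obs (v - 1))) C"
    using C obs_measurable assms by (simp add: emeasure_distr measurable_P_eq space_P)
  also have "distr (P d v) (PiM {1..v - 1} (\<lambda>_. \<mu>)) (obs (v - 1)) = PiM {1..v - 1} (\<lambda>k. density \<mu> (f (regime d v k)))"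
    using assms by (intro distr_obs_P)
  also have "\<dots> = PiM {1..v - 1} (\<lambda>_. density \<mu> (f 0))"
    using assms by (intro PiM_cong) (auto simp: regime_eq_0_iff[THEN iffD2])
  also have "emeasure \<dots> C = emeasure Pinf A"
    unfolding distr_obs_Pinf[symmetric] using C obs_measurable by (simp add: emeasure_distr)
  finally show ?thesis .
qed

subsection \<open>Change of measure\<close>

text \<open>The log-likelihood ratio of regime \<open>i\<close> against regime 0, written as an
  entropy density so that \<open>KL_integrable\<close> and \<open>KL_info\<close> apply to it
  directly.\<close>

definition llr :: "nat \<Rightarrow> 'a \<Rightarrow> real" where
  "llr i = entropy_density (exp 1) (density \<mu> (f 0)) (density \<mu> (f i))"

lemma llr_measurable [measurable]: "llr i \<in> borel_measurable \<mu>"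
  using measurable_entropy_density[of "exp 1" "density \<mu> (f 0)" "density \<mu> (f i)"]
  by (simp add: llr_def cong: measurable_cong_sets)

text \<open>\<open>lratio 0\<close> is \<open>1\<close> everywhere and not only almost everywhere, so that the observations before
  the change-point drop out of the likelihood ratio pointwise.\<close>

definition lratio :: "nat \<Rightarrow> 'a \<Rightarrow> real" where
  "lratio i x = (if i = 0 then 1 else enn2real (RN_deriv (density \<mu> (f 0)) (density \<mu> (f i)) x))"

lemma lratio_measurable [measurable]: "lratio i \<in> borel_measurable \<mu>"
  unfolding lratio_def
  using borel_measurable_RN_deriv[of "density \<mu> (f 0)" "density \<mu> (f i)"]
  by (cases "i = 0") (simp_all cong: measurable_cong_sets)

lemma lratio_nonneg: "0 \<le> lratio i x"
  by (simp add: lratio_def)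

text \<open>Only an inequality, because \<open>ln 0 = 0\<close> makes \<open>exp (llr i x) = 1\<close> where the ratio vanishes.\<close>

lemma lratio_le_exp_llr: "1 \<le> i \<Longrightarrow> lratio i x \<le> exp (llr i x)"
  unfolding lratio_def llr_def entropy_density_def
  by (cases "enn2real (RN_deriv (density \<mu> (f 0)) (density \<mu> (f i)) x) = 0")
     (auto simp: log_def less_le)

text \<open>This is the Radon-Nikodym theorem, with absolute continuity from \<open>KL_ac\<close>.
  The value 0 that \<open>enn2real\<close> gives at infinity does no harm, since the derivative
  between finite measures is finite almost everywhere.\<close>

lemma density_lratio:
  assumes "i \<le> L"
  shows "density (density \<mu> (f 0)) (\<lambda>x. ennreal (lratio i x)) = density \<mu> (f i)"
proof (cases "i = 0")
  case True
  then show ?thesis by (simp add: lratio_def density_1)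
next
  case False
  interpret P0: prob_space "density \<mu> (f 0)" by (rule density_prob) simp
  interpret Pi: prob_space "density \<mu> (f i)" by (rule density_prob) fact
  have ac: "absolutely_continuous (density \<mu> (f 0)) (density \<mu> (f i))"
    using False assms by (intro KL_ac) auto
  have s: "sets (density \<mu> (f i)) = sets (density \<mu> (f 0))" by simp
  obtain D where D: "AE x in density \<mu> (f 0). RN_deriv (density \<mu> (f 0)) (density \<mu> (f i)) x = ennreal (D x)"
    and D0: "\<And>x. 0 \<le> D x"
    using P0.real_RN_deriv[OF Pi.finite_measure_axioms ac s] by metis
  have "density (density \<mu> (f 0)) (\<lambda>x. ennreal (lratio i x)) =
    density (density \<mu> (f 0)) (RN_deriv (density \<mu> (f 0)) (density \<mu> (f i)))"
  proof (rule density_cong)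
    show "AE x in density \<mu> (f 0). ennreal (lratio i x) = RN_deriv (density \<mu> (f 0)) (density \<mu> (f i)) x"
      using D by eventually_elim (use False D0 in \<open>simp add: lratio_def\<close>)
  qed (simp_all cong: measurable_cong_sets)
  also have "\<dots> = density \<mu> (f i)"
    using ac s by (rule P0.density_RN_deriv)
  finally show ?thesis .
qed

definition LLR :: "(nat \<Rightarrow> nat) \<Rightarrow> nat \<Rightarrow> nat \<Rightarrow> 'w \<Rightarrow> real" where
  "LLR d v m \<omega> = (\<Sum>k\<in>{v..<v+m}. llr (regime d v k) (X k \<omega>))"

lemma llr_component_measurable:
  "k \<in> I \<Longrightarrow> (\<lambda>x. llr i (x k)) \<in> borel_measurable (PiM I (\<lambda>_. \<mu>))"
  by measurable

lemma LLR_measurable: "1 \<le> v \<Longrightarrow> LLR d v m \<in> borel_measurable Pinf"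
  unfolding LLR_def
  by (intro borel_measurable_sum measurable_compose[OF X_measurable llr_measurable]) auto

text \<open>Both \<open>A\<close> and \<open>LLR\<close> are functions of the first
  \<open>v + m - 1\<close> observations. The likelihood ratio of these has factors 1 before
  \<open>v\<close>, so where \<open>LLR\<close> is at most \<open>b\<close> it is at most
  \<open>exp b\<close>.\<close>

lemma change_of_measure:
  assumes L1: "1 \<le> L" and v: "1 \<le> v" and A: "A \<in> sets (obs_filtration \<mu> Pinf X (enat (v + m - 1)))"
  shows "measure (P d v) (A \<inter> {\<omega>. LLR d v m \<omega> \<le> b}) \<le> exp b * measure Pinf A"
proof -
  interpret Q: prob_space Pinf by (rule prob_Pinf)
  interpret Pv: prob_space "P d v" using v by (rule prob_P)
  define n where "n = v + m - 1"
  let ?r = "\<lambda>k. regime d v k"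
  let ?PM = "PiM {1..n} (\<lambda>_. \<mu>)"
  let ?Q = "PiM {1..n} (\<lambda>_. density \<mu> (f 0))"
  let ?S = "\<lambda>x. \<Sum>k\<in>{v..<v+m}. llr (?r k) (x k)"
  obtain C where C: "C \<in> sets ?PM" "A = obs n -` C \<inter> space Pinf"
    using A unfolding n_def by (rule sets_obs_filtration)
  have win: "{v..<v+m} \<subseteq> {1..n}" using v by (auto simp: n_def)
  have setsQ: "sets ?Q = sets ?PM" by (intro sets_PiM_cong) auto
  have S: "?S \<in> borel_measurable ?PM"
    using win by (intro borel_measurable_sum llr_component_measurable) auto
  define E where "E = C \<inter> {x \<in> space ?PM. ?S x \<le> b}"
  have "{x \<in> space ?PM. ?S x \<le> b} \<in> sets ?PM" using S by measurable
  with C(1) have E: "E \<in> sets ?PM" unfolding E_def by (rule sets.Int)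
  have AE: "A \<inter> {\<omega>. LLR d v m \<omega> \<le> b} = obs n -` E \<inter> space Pinf"
  proof -
    have "?S (obs n \<omega>) = LLR d v m \<omega>" for \<omega>
      unfolding LLR_def using win by (intro sum.cong) auto
    then show ?thesis using C(2) measurable_space[OF obs_measurable] by (auto simp: E_def)
  qed
  have dens: "PiM {1..n} (\<lambda>k. density \<mu> (f (?r k))) =
    density ?Q (\<lambda>x. \<Prod>k\<in>{1..n}. ennreal (lratio (?r k) (x k)))"
  proof -
    have eq: "density \<mu> (f (?r k)) = density (density \<mu> (f 0)) (\<lambda>x. ennreal (lratio (?r k) x))" for k
      using enat_less_change_time_regime(1)[OF L1, where d=d and v=v and k=k] by (simp add: density_lratio)
    have "sigma_finite_measure (density \<mu> (f 0))" "sigma_finite_measure (density \<mu> (f (?r k)))" for k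
      using density_prob[of 0] density_prob[OF enat_less_change_time_regime(1)[OF L1, where d=d and v=v and k=k]]
      by (simp_all add: prob_space_imp_sigma_finite)
    then show ?thesis
      unfolding eq by (intro PiM_density) (auto simp: eq[symmetric])
  qed
  have bound: "(\<Prod>k\<in>{1..n}. lratio (?r k) (x k)) \<le> exp b" if "x \<in> E" for x
  proof -
    have "(\<Prod>k\<in>{1..n}. lratio (?r k) (x k)) = (\<Prod>k\<in>{v..<v+m}. lratio (?r k) (x k))"
      using win L1 by (intro prod.mono_neutral_right) (auto simp: lratio_def n_def regime_eq_0_iff)
    also have "\<dots> \<le> (\<Prod>k\<in>{v..<v+m}. exp (llr (?r k) (x k)))"
      by (intro prod_mono conjI lratio_nonneg lratio_le_exp_llr regime_pos[OF L1]) simp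
    also have "\<dots> = exp (?S x)" by (simp add: exp_sum)
    also have "\<dots> \<le> exp b" using that by (simp add: E_def)
    finally show ?thesis .
  qed
  have "emeasure (P d v) (A \<inter> {\<omega>. LLR d v m \<omega> \<le> b}) = emeasure (distr (P d v) ?PM (obs n)) E"
    unfolding AE using E obs_measurable v by (simp add: emeasure_distr measurable_P_eq space_P)
  also have "\<dots> = emeasure (density ?Q (\<lambda>x. \<Prod>k\<in>{1..n}. ennreal (lratio (?r k) (x k)))) E"
    using distr_obs_P[OF L1 v] dens by simp
  also have "\<dots> = (\<integral>\<^sup>+x. (\<Prod>k\<in>{1..n}. ennreal (lratio (?r k) (x k))) * indicator E x \<partial>?Q)"
  proof (intro emeasure_density)
    show "E \<in> sets ?Q" using E setsQ by simp
    have "(\<lambda>x. \<Prod>k\<in>{1..n}. ennreal (lratio (?r k) (x k))) \<in> borel_measurable ?PM" by measurable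
    then show "(\<lambda>x. \<Prod>k\<in>{1..n}. ennreal (lratio (?r k) (x k))) \<in> borel_measurable ?Q"
      using setsQ by (simp cong: measurable_cong_sets)
  qed
  also have "\<dots> \<le> (\<integral>\<^sup>+x. ennreal (exp b) * indicator E x \<partial>?Q)"
    using bound by (intro nn_integral_mono)
      (auto simp: indicator_def prod_ennreal lratio_nonneg intro!: ennreal_leI)
  also have "\<dots> = ennreal (exp b) * emeasure ?Q E"
    using E setsQ by (simp add: nn_integral_cmult_indicator)
  also have "\<dots> \<le> ennreal (exp b) * emeasure ?Q C"
    using C setsQ by (intro mult_left_mono emeasure_mono) (auto simp: E_def)
  also have "emeasure ?Q C = emeasure Pinf A"
    unfolding distr_obs_Pinf[symmetric] using C obs_measurable by (simp add: emeasure_distr)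
  finally show ?thesis
    by (simp add: Q.emeasure_eq_measure Pv.emeasure_eq_measure ennreal_mult[symmetric])
qed

text \<open>The past and the window are disjoint blocks of independent observations. Conditioning on
  \<open>\<tau> \<ge> v\<close> therefore leaves the probability of a large \<open>LLR\<close>
  unchanged.\<close>

lemma LLR_indep_past:
  assumes L1: "1 \<le> L" and v: "1 \<le> v" and A: "A \<in> sets (obs_filtration \<mu> Pinf X (enat (v - 1)))"
  shows "measure (P d v) (A \<inter> {\<omega>. b < LLR d v m \<omega>}) =
    measure (P d v) A * measure (P d v) {\<omega>\<in>space Pinf. b < LLR d v m \<omega>}"
proof -
  interpret Pv: prob_space "P d v" using v by (rule prob_P)
  obtain C where C: "C \<in> sets (PiM {1..v - 1} (\<lambda>_. \<mu>))" "A = obs (v - 1) -` C \<inter> space Pinf"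
    using A by (rule sets_obs_filtration)
  let ?B = "{v..<v+m}"
  let ?S = "\<lambda>x. \<Sum>k\<in>?B. llr (regime d v k) (x k)"
  let ?D = "{x \<in> space (PiM ?B (\<lambda>_. \<mu>)). b < ?S x}"
  have "?S \<in> borel_measurable (PiM ?B (\<lambda>_. \<mu>))"
    by (intro borel_measurable_sum llr_component_measurable) auto
  then have D: "?D \<in> sets (PiM ?B (\<lambda>_. \<mu>))" by measurable
  have ind: "Pv.indep_var (PiM {1..v - 1} (\<lambda>_. \<mu>)) (obs (v - 1)) (PiM ?B (\<lambda>_. \<mu>)) (\<lambda>\<omega>. \<lambda>k\<in>?B. X k \<omega>)"
    using v by (intro Pv.indep_var_restrict[OF indep_P]) auto
  have rv: "(\<lambda>\<omega>. \<lambda>k\<in>?B. X k \<omega>) \<in> measurable Pinf (PiM ?B (\<lambda>_. \<mu>))"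
    using v by (intro measurable_restrict X_measurable) auto
  have eqD: "(\<lambda>\<omega>. \<lambda>k\<in>?B. X k \<omega>) -` ?D \<inter> space Pinf = {\<omega>\<in>space Pinf. b < LLR d v m \<omega>}"
    using measurable_space[OF rv] by (auto simp: LLR_def)
  have eqAD: "(\<lambda>\<omega>. (obs (v - 1) \<omega>, \<lambda>k\<in>?B. X k \<omega>)) -` (C \<times> ?D) \<inter> space Pinf =
    A \<inter> {\<omega>. b < LLR d v m \<omega>}"
    using eqD C(2) by blast
  show ?thesis
    using Pv.indep_varD[OF ind C(1) D] unfolding space_P[OF v] eqD C(2)[symmetric] eqAD .
qed

text \<open>The mean of each summand under \<open>P d v\<close> is the divergence of its regime, so
  \<open>b\<close> exceeds the mean of \<open>LLR\<close> by at least \<open>t\<close> and the weak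
  law applies. The right-hand side does not depend on \<open>v\<close>.\<close>

lemma LLR_deviation:
  assumes L1: "1 \<le> L" and v: "1 \<le> v" and t: "0 < t"
    and mean: "(\<Sum>k\<in>{v..<v+m}. KL_info \<mu> f (regime d v k)) + t \<le> b"
    and B: "0 \<le> B" and tail: "\<And>i. 1 \<le> i \<Longrightarrow> i \<le> L \<Longrightarrow>
      (\<integral>x. (if B < \<bar>llr i x\<bar> then \<bar>llr i x\<bar> else 0) \<partial>density \<mu> (f i)) \<le> e"
  shows "measure (P d v) {\<omega>\<in>space Pinf. b < LLR d v m \<omega>} \<le> 4 * m * B\<^sup>2 / t\<^sup>2 + 4 * m * e / t"
proof -
  interpret Pv: prob_space "P d v" using v by (rule prob_P)
  let ?r = "\<lambda>k. regime d v k" and ?J = "{v..<v+m}"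
  let ?Z = "\<lambda>k \<omega>. llr (?r k) (X k \<omega>)"
  have r: "1 \<le> ?r k" "?r k \<le> L" if "k \<in> ?J" for k
    using enat_less_change_time_regime(1)[OF L1] regime_pos[OF L1, where d=d and v=v and k=k] that
    by auto
  have Xm: "X k \<in> measurable (P d v) \<mu>" if "k \<in> ?J" for k
    using X_measurable[of k] that v by (simp add: measurable_P_eq)
  have dX: "distr (P d v) \<mu> (X k) = density \<mu> (f (?r k))" if "k \<in> ?J" for k
    using distributed_regime[OF L1 v, of k d] that v by (simp add: distributed_def)
  have int: "integrable (P d v) (?Z k)" if "k \<in> ?J" for k
    using KL_integrable[OF r[OF that]] that Xm[OF that] dX[OF that]
    by (simp add: llr_def[symmetric] integrable_distr_eq[OF Xm[OF that], symmetric])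
  have E: "Pv.expectation (?Z k) = KL_info \<mu> f (?r k)" if "k \<in> ?J" for k
    using Xm[OF that] dX[OF that] 
    by (simp add: KL_info_def KL_divergence_def llr_def[symmetric] integral_distr[OF Xm[OF that], symmetric])
  have "measure (P d v) {\<omega>\<in>space (P d v). t \<le> (\<Sum>k\<in>?J. ?Z k \<omega>) - (\<Sum>k\<in>?J. Pv.expectation (?Z k))}
    \<le> 4 * card ?J * B\<^sup>2 / t\<^sup>2 + 4 * card ?J * e / t"
  proof (rule Pv.indep_vars_sum_deviation[OF _ _ int _ B t])
    show "Pv.indep_vars (\<lambda>_. borel) ?Z ?J"
      by (rule Pv.indep_vars_compose2[OF Pv.indep_vars_subset[OF indep_P[OF v]], where Y="\<lambda>k. llr (?r k)"])
         (use v in auto)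
    show "Pv.expectation (\<lambda>\<omega>. if B < \<bar>?Z k \<omega>\<bar> then \<bar>?Z k \<omega>\<bar> else 0) \<le> e" if "k \<in> ?J" for k
    proof -
      have "Pv.expectation (\<lambda>\<omega>. if B < \<bar>?Z k \<omega>\<bar> then \<bar>?Z k \<omega>\<bar> else 0) =
        (\<integral>x. (if B < \<bar>llr (?r k) x\<bar> then \<bar>llr (?r k) x\<bar> else 0) \<partial>distr (P d v) \<mu> (X k))"
        using Xm[OF that] by (subst integral_distr) auto
      then show ?thesis using tail[OF r[OF that]] dX[OF that] by simp
    qed
  qed auto
  moreover have "measure (P d v) {\<omega>\<in>space Pinf. b < LLR d v m \<omega>} \<le>
    measure (P d v) {\<omega>\<in>space (P d v). t \<le> (\<Sum>k\<in>?J. ?Z k \<omega>) - (\<Sum>k\<in>?J. Pv.expectation (?Z k))}"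
  proof (rule Pv.finite_measure_mono)
    show "{\<omega>\<in>space Pinf. b < LLR d v m \<omega>} \<subseteq>
      {\<omega>\<in>space (P d v). t \<le> (\<Sum>k\<in>?J. ?Z k \<omega>) - (\<Sum>k\<in>?J. Pv.expectation (?Z k))}"
      using mean E v by (auto simp: LLR_def space_P)
    have "?Z k \<in> borel_measurable (P d v)" if "k \<in> ?J" for k using int[OF that] by auto
    then show "{\<omega>\<in>space (P d v). t \<le> (\<Sum>k\<in>?J. ?Z k \<omega>) - (\<Sum>k\<in>?J. Pv.expectation (?Z k))} \<in> Pv.events"
      by measurable
  qed
  ultimately show ?thesis by simp
qed

subsection \<open>Detection delays\<close>

lemma space_obs_filtration: "space (obs_filtration \<mu> \<Omega> X t) = space \<Omega>"
  unfolding obs_filtration_def by (rule space_measure_of) auto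

lemma obs_filtration_P: "1 \<le> v \<Longrightarrow> obs_filtration \<mu> (P d v) X t = obs_filtration \<mu> Pinf X t"
  by (simp add: obs_filtration_def space_P)

text \<open>The event \<open>\<tau> \<ge> v\<close> is the complement of
  \<open>\<tau> \<le> v - 1\<close>, hence decided strictly before the change. Both the agreement of
  the two laws and the independence of the window rely on this.\<close>

lemma stopping_sets:
  assumes \<tau>: "stopping_time (obs_filtration \<mu> Pinf X) \<tau>"
  shows "{\<omega>\<in>space Pinf. \<tau> \<omega> \<le> enat n} \<in> sets (obs_filtration \<mu> Pinf X (enat n))"
    and "1 \<le> v \<Longrightarrow> {\<omega>\<in>space Pinf. enat v \<le> \<tau> \<omega>} \<in> sets (obs_filtration \<mu> Pinf X (enat (v - 1)))"
proof -
  let ?F = "\<lambda>n. obs_filtration \<mu> Pinf X (enat n)"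
  show le: "{\<omega>\<in>space Pinf. \<tau> \<omega> \<le> enat n} \<in> sets (?F n)" for n
    using stopping_timeD[OF \<tau>, of "enat n"] unfolding pred_def space_obs_filtration .
  show "{\<omega>\<in>space Pinf. enat v \<le> \<tau> \<omega>} \<in> sets (?F (v - 1))" if "1 \<le> v"
  proof -
    have "enat v \<le> \<tau> \<omega> \<longleftrightarrow> \<not> \<tau> \<omega> \<le> enat (v - 1)" for \<omega>
      using that by (cases "\<tau> \<omega>") auto
    then have "{\<omega>\<in>space Pinf. enat v \<le> \<tau> \<omega>} = space (?F (v - 1)) - {\<omega>\<in>space Pinf. \<tau> \<omega> \<le> enat (v - 1)}"
      by (auto simp: space_obs_filtration)
    then show ?thesis using le[of "v - 1"] by (simp add: sets.compl_sets)
  qed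
qed

lemma stopping_window_sets:
  assumes \<tau>: "stopping_time (obs_filtration \<mu> Pinf X) \<tau>" and v: "1 \<le> v"
  shows "{\<omega>\<in>space Pinf. enat v \<le> \<tau> \<omega> \<and> \<tau> \<omega> < enat (v + m)} \<in> sets (obs_filtration \<mu> Pinf X (enat (v + m - 1)))"
proof -
  let ?F = "obs_filtration \<mu> Pinf X (enat (v + m - 1))"
  have "\<tau> \<omega> < enat (v + m) \<longleftrightarrow> \<tau> \<omega> \<le> enat (v + m - 1)" for \<omega>
    using v by (cases "\<tau> \<omega>") auto
  then have "{\<omega>\<in>space Pinf. enat v \<le> \<tau> \<omega> \<and> \<tau> \<omega> < enat (v + m)} =
    {\<omega>\<in>space Pinf. enat v \<le> \<tau> \<omega>} \<inter> {\<omega>\<in>space Pinf. \<tau> \<omega> \<le> enat (v + m - 1)}"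
    by auto
  moreover have "{\<omega>\<in>space Pinf. enat v \<le> \<tau> \<omega>} \<in> sets ?F"
    using stopping_sets(2)[OF \<tau> v] obs_filtration_mono[OF diff_le_mono[OF le_add1]] by blast
  ultimately show ?thesis using stopping_sets(1)[OF \<tau>] by auto
qed

text \<open>As \<open>enat\<close> is countable, preimages of points suffice. That of infinity,
  about which \<open>stopping_time\<close> says nothing, is the complement of a countable union of
  events \<open>\<tau> \<le> n\<close>.\<close>

lemma stopping_measurable:
  assumes \<tau>: "stopping_time (obs_filtration \<mu> Pinf X) \<tau>"
  shows "\<tau> \<in> measurable Pinf (count_space UNIV)"
proof (subst measurable_count_space_eq2_countable, intro conjI ballI)
  have le: "{\<omega>\<in>space Pinf. \<tau> \<omega> \<le> enat n} \<in> sets Pinf" for n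
    using stopping_sets(1)[OF \<tau>] by (rule sets_obs_filtration_subset)
  fix a :: enat
  show "\<tau> -` {a} \<inter> space Pinf \<in> sets Pinf"
  proof (cases a)
    case (enat n)
    have "{\<omega>\<in>space Pinf. enat n \<le> \<tau> \<omega>} \<in> sets Pinf"
    proof (cases "1 \<le> n")
      case True
      then show ?thesis using stopping_sets(2)[OF \<tau>] by (auto intro: sets_obs_filtration_subset)
    next
      case False
      then have "n = 0" by simp
      then show ?thesis by (simp add: zero_enat_def[symmetric])
    qed
    moreover have "\<tau> -` {a} \<inter> space Pinf = {\<omega>\<in>space Pinf. enat n \<le> \<tau> \<omega>} \<inter> {\<omega>\<in>space Pinf. \<tau> \<omega> \<le> enat n}"
      using enat by auto
    ultimately show ?thesis using le[of n] by auto
  next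
    case infinity
    have "\<tau> \<omega> = \<infinity> \<longleftrightarrow> (\<forall>n. \<not> \<tau> \<omega> \<le> enat n)" for \<omega>
      by (cases "\<tau> \<omega>") auto
    then have "\<tau> -` {a} \<inter> space Pinf = space Pinf - (\<Union>n. {\<omega>\<in>space Pinf. \<tau> \<omega> \<le> enat n})"
      using infinity by auto
    then show ?thesis using le by auto
  qed
qed auto

text \<open>Given \<open>\<tau> \<ge> v\<close> at a low-hazard \<open>v\<close>, the window of
  length \<open>m\<close> passes without a stop with probability at least \<open>1 - q\<close>, and
  then the delay is at least \<open>m\<close>. The bound \<open>p\<close> is required for all
  \<open>v\<close> because the low-hazard \<open>v\<close> depends on \<open>\<tau>\<close>.\<close>

lemma pollak_delay_ge:
  assumes L1: "1 \<le> L" and \<tau>: "\<tau> \<in> stopping_class \<mu> X Pinf \<gamma>" and \<gamma>: "0 < \<gamma>" and m: "1 \<le> m"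
    and p: "\<And>v. 1 \<le> v \<Longrightarrow> measure (P d v) {\<omega>\<in>space Pinf. b < LLR d v m \<omega>} \<le> p"
  shows "ennreal (m * (1 - (exp b * (2 * real m / \<gamma>) + p))) \<le> pollak_delay (P d) \<tau>"
proof -
  interpret Q: prob_space Pinf by (rule prob_Pinf)
  have st: "stopping_time (obs_filtration \<mu> Pinf X) \<tau>"
    and mean: "ennreal \<gamma> \<le> (\<integral>\<^sup>+\<omega>. ennreal_of_enat (\<tau> \<omega>) \<partial>Pinf)"
    using \<tau> by (auto simp: stopping_class_def)
  have \<tau>m: "\<tau> \<in> measurable Pinf (count_space UNIV)" using st by (rule stopping_measurable)
  obtain v where v: "1 \<le> v" and pos: "0 < Q.prob {\<omega>\<in>space Pinf. enat v \<le> \<tau> \<omega>}"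
    and low: "Q.prob {\<omega>\<in>space Pinf. enat v \<le> \<tau> \<omega> \<and> \<tau> \<omega> < enat (v + m)}
      \<le> 2 * real m / \<gamma> * Q.prob {\<omega>\<in>space Pinf. enat v \<le> \<tau> \<omega>}"
    using Q.exists_low_hazard_window[OF \<tau>m mean \<gamma> m] by blast
  interpret Pv: prob_space "P d v" using v by (rule prob_P)
  define T where "T = {\<omega>\<in>space Pinf. enat v \<le> \<tau> \<omega>}"
  define H where "H = {\<omega>\<in>space Pinf. enat v \<le> \<tau> \<omega> \<and> \<tau> \<omega> < enat (v + m)}"
  define q where "q = exp b * (2 * real m / \<gamma>) + p"
  have TF: "T \<in> sets (obs_filtration \<mu> Pinf X (enat (v - 1)))"
    unfolding T_def using stopping_sets(2)[OF st v] .
  have HF: "H \<in> sets (obs_filtration \<mu> Pinf X (enat (v + m - 1)))"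
    unfolding H_def using stopping_window_sets[OF st v] .
  have Tm [measurable]: "T \<in> Pv.events" and Hm [measurable]: "H \<in> Pv.events"
    using TF HF v by (auto simp: sets_P intro: sets_obs_filtration_subset)
  have LLRm [measurable]: "LLR d v m \<in> borel_measurable (P d v)"
    using LLR_measurable[OF v] v by (simp add: measurable_P_eq)
  have \<tau>m' [measurable]: "\<tau> \<in> measurable (P d v) (count_space UNIV)"
    using \<tau>m v by (simp add: measurable_P_eq)
  have PT: "Pv.prob T = Q.prob T"
    using P_eq_Pinf_before_change[OF L1 v TF] by (simp add: measure_def)
  have spm: "A \<inter> {\<omega>. LLR d v m \<omega> \<le> b} \<in> Pv.events" "A \<inter> {\<omega>. b < LLR d v m \<omega>} \<in> Pv.events"
    if A: "A \<in> Pv.events" for A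
  proof -
    have "A \<inter> {\<omega>. LLR d v m \<omega> \<le> b} = A \<inter> {\<omega>\<in>space (P d v). LLR d v m \<omega> \<le> b}"
      "A \<inter> {\<omega>. b < LLR d v m \<omega>} = A \<inter> {\<omega>\<in>space (P d v). b < LLR d v m \<omega>}"
      using sets.sets_into_space[OF A] by auto
    then show "A \<inter> {\<omega>. LLR d v m \<omega> \<le> b} \<in> Pv.events" "A \<inter> {\<omega>. b < LLR d v m \<omega>} \<in> Pv.events"
      using A by auto
  qed
  \<comment> \<open>Where \<open>LLR\<close> is at most \<open>b\<close>, the change of measure
    controls \<open>H\<close>; elsewhere \<open>H\<close> is enlarged to \<open>T\<close>, which is
    independent of \<open>LLR\<close>.\<close>
  have "Pv.prob H \<le> Pv.prob ((H \<inter> {\<omega>. LLR d v m \<omega> \<le> b}) \<union> (T \<inter> {\<omega>. b < LLR d v m \<omega>}))"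
    using Hm Tm by (intro Pv.finite_measure_mono sets.Un spm) (auto simp: H_def T_def)
  also have "\<dots> \<le> Pv.prob (H \<inter> {\<omega>. LLR d v m \<omega> \<le> b}) + Pv.prob (T \<inter> {\<omega>. b < LLR d v m \<omega>})"
    using Hm Tm by (intro measure_Un_le spm)
  also have "Pv.prob (H \<inter> {\<omega>. LLR d v m \<omega> \<le> b}) \<le> exp b * Q.prob H"
    using change_of_measure[OF L1 v HF] .
  \<comment> \<open>The hazard bound holds under \<open>Pinf\<close>; it can be expressed by
    \<open>Pv.prob T\<close> because \<open>T\<close> is decided before the change.\<close>
  also have "exp b * Q.prob H \<le> exp b * (2 * real m / \<gamma> * Pv.prob T)"
    using low unfolding PT unfolding H_def T_def by (intro mult_left_mono) auto
  also have "Pv.prob (T \<inter> {\<omega>. b < LLR d v m \<omega>}) \<le> Pv.prob T * p"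
    using LLR_indep_past[OF L1 v TF, of d b m] p[OF v] by (simp add: mult_left_mono)
  finally have H_le: "Pv.prob H \<le> q * Pv.prob T" by (simp add: q_def algebra_simps)
  have T0: "0 < Pv.prob T" using pos PT by (simp add: T_def)
  \<comment> \<open>No bound \<open>q \<le> 1\<close> is assumed: for larger \<open>q\<close>,
    \<open>ennreal\<close> truncates the left side to 0.\<close>
  have "ennreal (m * (1 - q)) * ennreal (Pv.prob T) = ennreal (m * ((1 - q) * Pv.prob T))"
    using T0 by (simp add: ennreal_mult''[symmetric] mult.assoc)
  also have "\<dots> \<le> ennreal (m * Pv.prob (T - H))"
  proof (intro ennreal_leI mult_left_mono)
    have "Pv.prob (T - H) = Pv.prob T - Pv.prob H"
      using Tm Hm by (rule Pv.finite_measure_Diff) (auto simp: T_def H_def)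
    then show "(1 - q) * Pv.prob T \<le> Pv.prob (T - H)" using H_le by (simp add: algebra_simps)
  qed simp
  also have "\<dots> = (\<integral>\<^sup>+\<omega>. ennreal m * indicator (T - H) \<omega> \<partial>P d v)"
    by (simp add: nn_integral_cmult_indicator Pv.emeasure_eq_measure ennreal_mult)
  also have "\<dots> \<le> (\<integral>\<^sup>+\<omega>. ennreal_of_enat (\<tau> \<omega> - enat v) * indicator T \<omega> \<partial>P d v)"
  proof (intro nn_integral_mono)
    fix \<omega>
    have "ennreal m \<le> ennreal_of_enat (\<tau> \<omega> - enat v)" if "\<omega> \<in> T - H"
    proof (cases "\<tau> \<omega>")
      case (enat n)
      then have "m \<le> n - v" using that by (auto simp: T_def H_def)
      then show ?thesis using enat by (simp add: ennreal_of_nat_eq_real_of_nat)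
    qed simp
    then show "ennreal m * indicator (T - H) \<omega> \<le> ennreal_of_enat (\<tau> \<omega> - enat v) * indicator T \<omega>"
      by (auto simp: indicator_def)
  qed
  finally have *: "ennreal (m * (1 - q)) * ennreal (Pv.prob T) \<le>
    (\<integral>\<^sup>+\<omega>. ennreal_of_enat (\<tau> \<omega> - enat v) * indicator T \<omega> \<partial>P d v)" .
  have "ennreal (m * (1 - q)) = ennreal (m * (1 - q)) * ennreal (Pv.prob T) / ennreal (Pv.prob T)"
    using T0 by (simp add: ennreal_mult_divide_eq)
  also have "\<dots> \<le> (\<integral>\<^sup>+\<omega>. ennreal_of_enat (\<tau> \<omega> - enat v) * indicator T \<omega> \<partial>P d v) / emeasure (P d v) T"
    using * by (simp add: Pv.emeasure_eq_measure divide_right_mono_ennreal)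
  also have "\<dots> = (\<integral>\<^sup>+\<omega>. ennreal_of_enat (\<tau> \<omega> - enat v) \<partial>uniform_measure (P d v) T)"
    by (intro nn_integral_uniform_measure[symmetric]) auto
  also have "T = {\<omega> \<in> space (P d v). enat v \<le> \<tau> \<omega>}" using v by (simp add: T_def space_P)
  finally show ?thesis
    unfolding pollak_delay_def q_def using v by (intro SUP_upper2[of v]) auto
qed

text \<open>For each \<open>v\<close> the conditioning event lies in
  \<open>\<F>\<^sub>v\<^sub>-\<^sub>1\<close>. Pollak's term is thus the average over it of the
  conditional expectation whose essential supremum is Lorden's term.\<close>

lemma pollak_delay_le_lorden_delay:
  assumes \<tau>: "\<tau> \<in> stopping_class \<mu> X Pinf \<gamma>"
  shows "pollak_delay (P d) \<tau> \<le> lorden_delay \<mu> X (P d) \<tau>"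
  unfolding pollak_delay_def lorden_delay_def
proof (rule SUP_mono, rule bexI)
  fix v :: nat assume v': "v \<in> {1..}"
  then have v: "1 \<le> v" by simp
  have st: "stopping_time (obs_filtration \<mu> Pinf X) \<tau>"
    using \<tau> by (auto simp: stopping_class_def)
  interpret Pv: prob_space "P d v" using v by (rule prob_P)
  let ?F = "obs_filtration \<mu> (P d v) X (enat (v - 1))"
  have FP: "?F = obs_filtration \<mu> Pinf X (enat (v - 1))" using v by (rule obs_filtration_P)
  have sub: "subalgebra (P d v) ?F"
    unfolding subalgebra_def FP sets_P[OF v] space_P[OF v] space_obs_filtration
    using sets_obs_filtration_subset by blast
  interpret sigma_finite_subalgebra "P d v" ?F
    by (rule finite_measure_subalgebra_is_sigma_finite) (standard, rule sub)
  let ?g = "\<lambda>\<omega>. ennreal_of_enat (\<tau> \<omega> - enat v)"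
  let ?T = "{\<omega> \<in> space (P d v). enat v \<le> \<tau> \<omega>}"
  have TF: "?T \<in> sets ?F"
    unfolding FP space_P[OF v] using stopping_sets(2)[OF st v] .
  have T: "?T \<in> Pv.events" using TF sub by (auto simp: subalgebra_def)
  have [measurable]: "\<tau> \<in> measurable (P d v) (count_space UNIV)"
    using stopping_measurable[OF st] v by (simp add: measurable_P_eq)
  have g: "?g \<in> borel_measurable (P d v)" by measurable
  let ?E = "nn_cond_exp (P d v) ?F ?g"
  have "(\<integral>\<^sup>+\<omega>. ?g \<omega> * indicator ?T \<omega> \<partial>P d v) = (\<integral>\<^sup>+\<omega>. indicator ?T \<omega> * ?E \<omega> \<partial>P d v)"
    using TF g by (subst nn_cond_exp_intg) (auto simp: mult.commute)
  also have "\<dots> \<le> (\<integral>\<^sup>+\<omega>. esssup (P d v) ?E * indicator ?T \<omega> \<partial>P d v)"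
    using esssup_AE[of ?E "P d v"]
    by (intro nn_integral_mono_AE, eventually_elim) (auto simp: indicator_def)
  also have "\<dots> = esssup (P d v) ?E * emeasure (P d v) ?T"
    using T by (simp add: nn_integral_cmult_indicator)
  finally have *: "(\<integral>\<^sup>+\<omega>. ?g \<omega> * indicator ?T \<omega> \<partial>P d v) \<le> esssup (P d v) ?E * emeasure (P d v) ?T" .
  have "(\<integral>\<^sup>+\<omega>. ?g \<omega> \<partial>uniform_measure (P d v) ?T) = (\<integral>\<^sup>+\<omega>. ?g \<omega> * indicator ?T \<omega> \<partial>P d v) / emeasure (P d v) ?T"
    using g T by (rule nn_integral_uniform_measure)
  also have "\<dots> \<le> esssup (P d v) ?E"
  proof (cases "emeasure (P d v) ?T = 0")
    \<comment> \<open>With a null conditioning event the quotient is \<open>0 / 0\<close>, which is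
      0 in \<open>ennreal\<close>.\<close>
    case True
    then have "(\<integral>\<^sup>+\<omega>. ?g \<omega> * indicator ?T \<omega> \<partial>P d v) = 0" using * by simp
    then show ?thesis by simp
  next
    case False
    then show ?thesis using * by (intro divide_le_posI_ennreal) (auto simp: zero_less_iff_neq_zero mult.commute)
  qed
  finally show "(\<integral>\<^sup>+\<omega>. ?g \<omega> \<partial>uniform_measure (P d v) ?T) \<le> esssup (P d v) ?E" .
qed 

subsection \<open>Information in a window\<close>

lemma change_time_eq:
  "j < L \<Longrightarrow> change_time L d v (Suc j) = enat (v + (\<Sum>i=1..j. d i))"
  by (induction j) (auto simp: add.assoc)

text \<open>Regimes \<open>i < h\<close> hold at most \<open>d i\<close> window points each, and
  regime \<open>h\<close> only those beyond the first \<open>h - 1\<close> durations. The truncated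
  subtraction covers windows that end before regime \<open>h\<close>. For \<open>h = L\<close> the
  last regime is unbounded, so no limit on \<open>m\<close> is imposed.\<close>

lemma sum_KL_info_regime_le:
  assumes v: "1 \<le> v" and h: "1 \<le> h" "h \<le> L" and m: "h < L \<Longrightarrow> m \<le> (\<Sum>i=1..h. d i)"
  shows "(\<Sum>k\<in>{v..<v+m}. KL_info \<mu> f (regime d v k)) \<le>
    (\<Sum>i=1..h-1. d i * KL_info \<mu> f i) + real (m - (\<Sum>i=1..h-1. d i)) * KL_info \<mu> f h"
proof -
  let ?r = "regime d v" and ?J = "{v..<v+m}" and ?I = "KL_info \<mu> f"
  have L1: "1 \<le> L" using h by simp
  have r: "?r k \<in> {1..h}" if "k \<in> ?J" for k
  proof -
    have "?r k \<le> h"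
    proof (cases "h < L")
      case True
      then have "enat k < change_time L d v (Suc h)" using that m by (subst change_time_eq) auto
      then show ?thesis unfolding regime_def by (rule Least_le)
    next
      case False
      then show ?thesis using enat_less_change_time_regime(1)[OF L1, where d=d and v=v and k=k] h by simp
    qed
    then show ?thesis using regime_pos[OF L1, of v k d] that by simp
  qed
  let ?K = "\<lambda>i. {k \<in> ?J. ?r k = i}"
  have lower: "v + (\<Sum>j=1..i-1. d j) \<le> k" if "k \<in> ?J" "?r k = i" for k i
  proof -
    have "i \<in> {1..h}" using r[OF that(1)] that(2) by simp
    then have "change_time L d v (Suc (i - 1)) \<le> enat k"
      using change_time_regime_le[where d=d and v=v and k=k] that v h r[OF that(1)]
        enat_less_change_time_regime(1)[OF L1, where d=d and v=v and k=k]
      by (cases "1 \<le> k") auto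
    then show ?thesis using \<open>i \<in> {1..h}\<close> h by (subst (asm) change_time_eq) auto
  qed
  have upper: "k < v + (\<Sum>j=1..i. d j)" if "k \<in> ?J" "?r k = i" "i < L" for k i
    using enat_less_change_time_regime(2)[OF L1, where d=d and v=v and k=k] that
    by (simp only: change_time_eq enat_ord_simps)
  have card_le: "card (?K i) \<le> d i" if "i \<in> {1..h-1}" for i
  proof -
    have "(\<Sum>j=1..i. d j) = (\<Sum>j=1..i-1. d j) + d i"
      using that by (cases i) auto
    then have "?K i \<subseteq> {v + (\<Sum>j=1..i-1. d j) ..< v + (\<Sum>j=1..i-1. d j) + d i}"
      using lower upper[of _ i] that h by (fastforce simp: subset_iff)
    then have "card (?K i) \<le> card {v + (\<Sum>j=1..i-1. d j) ..< v + (\<Sum>j=1..i-1. d j) + d i}"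
      by (intro card_mono) auto
    then show ?thesis by simp
  qed
  have "?K h \<subseteq> {v + (\<Sum>j=1..h-1. d j) ..< v + m}"
    using lower by auto
  then have "card (?K h) \<le> card {v + (\<Sum>j=1..h-1. d j) ..< v + m}"
    by (intro card_mono) auto
  then have card_h: "card (?K h) \<le> m - (\<Sum>i=1..h-1. d i)" by simp
  have "(\<Sum>k\<in>?J. ?I (?r k)) = (\<Sum>i\<in>{1..h}. \<Sum>k\<in>?K i. ?I (?r k))"
    using r by (intro sum.group[symmetric]) auto
  also have "\<dots> = (\<Sum>i\<in>{1..h}. card (?K i) * ?I i)" by (intro sum.cong) auto
  also have "\<dots> = (\<Sum>i=1..h-1. card (?K i) * ?I i) + card (?K h) * ?I h"
    using h by (cases h) auto
  also have "\<dots> \<le> (\<Sum>i=1..h-1. d i * ?I i) + real (m - (\<Sum>i=1..h-1. d i)) * ?I h"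
    using card_le card_h h less_imp_le[OF KL_pos]
    by (intro add_mono sum_mono mult_right_mono) auto
  finally show ?thesis .
qed

subsection \<open>Asymptotics\<close>

text \<open>This fixes the parameters of the argument for a given relative loss
  \<open>\<delta>\<close>. Regime \<open>h\<close> enters through one-sided bounds only, since its
  limiting ratio may be infinite.\<close>

lemma eventually_pollak_delay_ge:
  fixes d :: "real \<Rightarrow> nat \<Rightarrow> nat" and c :: "nat \<Rightarrow> real" and h :: nat and \<delta> :: real
  assumes h: "1 \<le> h" "h \<le> L"
    and lim: "\<And>i. 1 \<le> i \<Longrightarrow> i < h \<Longrightarrow> ((\<lambda>\<gamma>. d \<gamma> i * KL_info \<mu> f i / ln \<gamma>) \<longlongrightarrow> c i) at_top"
    and c0: "\<And>i. 0 \<le> c i"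
    and s1: "(\<Sum>i=1..h-1. c i) < 1"
    and lim_h: "\<And>y. h < L \<Longrightarrow> y < 1 - (\<Sum>i=1..h-1. c i) \<Longrightarrow>
      \<forall>\<^sub>F \<gamma> in at_top. y \<le> d \<gamma> h * KL_info \<mu> f h / ln \<gamma>"
    and \<delta>: "0 < \<delta>" "\<delta> < 1"
  defines "K \<equiv> (\<Sum>i=1..h-1. c i / KL_info \<mu> f i) + (1 - (\<Sum>i=1..h-1. c i)) / KL_info \<mu> f h"
  shows "\<forall>\<^sub>F \<gamma> in at_top. \<forall>\<tau>\<in>stopping_class \<mu> X Pinf \<gamma>.
    ennreal ((1 - \<delta>) * (K * ln \<gamma>)) \<le> pollak_delay (P (d \<gamma>)) \<tau>"
proof -
  define I where "I i = KL_info \<mu> f i" for i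
  define s where "s = (\<Sum>i=1..h-1. c i)"
  define w where "w = (\<Sum>i=1..h-1. c i / I i)"
  have I: "0 < I i" if "1 \<le> i" "i \<le> L" for i using KL_pos[OF that] by (simp add: I_def)
  have Ih: "0 < I h" using I h by simp
  have K: "K = w + (1 - s) / I h" by (simp add: K_def w_def s_def I_def)
  have w0: "0 \<le> w" unfolding w_def using c0 I h by (intro sum_nonneg divide_nonneg_pos) auto
  have K0: "0 < K" unfolding K using w0 s1 Ih by (intro add_nonneg_pos divide_pos_pos) (auto simp: s_def)
  \<comment> \<open>The loss \<open>\<delta>\<close> has three equal shares: the shorter window, the
    probability of stopping in it, and the rounding of its length.\<close>
  define \<eta> where "\<eta> = \<delta> / 3"
  have \<eta>: "0 < \<eta>" "\<eta> < 1" using \<delta> by (auto simp: \<eta>_def)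
  \<comment> \<open>After division by \<open>ln \<gamma>\<close>, the mean of \<open>LLR\<close> is
    bounded by expressions tending to \<open>s\<close> or to \<open>1 - \<eta> * K * I h\<close>,
    according to whether the window ends before regime \<open>h\<close> or reaches it. Both limits
    lie below \<open>1 - 2 * \<kappa>\<close>.\<close>
  define \<kappa> where "\<kappa> = min (1 - s) (\<eta> * K * I h) / 4"
  have \<kappa>0: "0 < \<kappa>" using s1 \<eta> K0 Ih by (simp add: \<kappa>_def s_def)
  have \<kappa>s: "s < 1 - 2 * \<kappa>" and \<kappa>K: "1 - \<eta> * K * I h < 1 - 2 * \<kappa>"
  proof -
    have "4 * \<kappa> \<le> 1 - s" "4 * \<kappa> \<le> \<eta> * K * I h"
      by (simp_all add: \<kappa>_def)
    then show "s < 1 - 2 * \<kappa>" "1 - \<eta> * K * I h < 1 - 2 * \<kappa>" using \<kappa>0 by simp_all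
  qed
  \<comment> \<open>Chosen so that the remainder term of the weak law is at most
    \<open>\<eta> / 4\<close> for windows no longer than \<open>K * ln \<gamma>\<close>.\<close>
  define e where "e = \<eta> * \<kappa> / (16 * K)"
  have e0: "0 < e" using \<eta> \<kappa>0 K0 by (simp add: e_def)

  \<comment> \<open>One level serves all regimes: there are finitely many, and the tail integral
    decreases as the level grows.\<close>
  have "\<exists>B. 0 \<le> B \<and> (\<forall>i\<in>{1..L}. (\<integral>x. (if B < \<bar>llr i x\<bar> then \<bar>llr i x\<bar> else 0) \<partial>density \<mu> (f i)) \<le> e)"
  proof -
    have "\<exists>B\<ge>0. (\<integral>x. (if B < \<bar>llr i x\<bar> then \<bar>llr i x\<bar> else 0) \<partial>density \<mu> (f i)) \<le> e" if "i \<in> {1..L}" for i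
    proof -
      have "integrable (density \<mu> (f i)) (llr i)" using KL_integrable[of i] that by (simp add: llr_def)
      then show ?thesis using integrable_tail_small[OF _ e0] by metis
    qed
    then obtain b where b: "\<And>i. i \<in> {1..L} \<Longrightarrow> 0 \<le> b i"
      "\<And>i. i \<in> {1..L} \<Longrightarrow> (\<integral>x. (if b i < \<bar>llr i x\<bar> then \<bar>llr i x\<bar> else 0) \<partial>density \<mu> (f i)) \<le> e"
      by metis
    define B where "B = Max (b ` {1..L})"
    have bB: "b i \<le> B" if "i \<in> {1..L}" for i using that unfolding B_def by (intro Max_ge) auto
    have "0 \<le> B" using b(1)[of h] bB[of h] h by simp
    moreover have "(\<integral>x. (if B < \<bar>llr i x\<bar> then \<bar>llr i x\<bar> else 0) \<partial>density \<mu> (f i)) \<le> e" if i: "i \<in> {1..L}" for i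
    proof -
      have int: "integrable (density \<mu> (f i)) (llr i)" using KL_integrable[of i] i by (simp add: llr_def)
      have "integrable (density \<mu> (f i)) (\<lambda>x. if B < \<bar>llr i x\<bar> then \<bar>llr i x\<bar> else 0)" for B
        using int by (rule Bochner_Integration.integrable_bound) auto
      then have "(\<integral>x. (if B < \<bar>llr i x\<bar> then \<bar>llr i x\<bar> else 0) \<partial>density \<mu> (f i)) \<le>
        (\<integral>x. (if b i < \<bar>llr i x\<bar> then \<bar>llr i x\<bar> else 0) \<partial>density \<mu> (f i))"
        using bB[OF i] by (intro integral_mono) auto
      then show ?thesis using b(2)[OF i] by simp
    qed
    ultimately show ?thesis by blast
  qed
  then obtain B where B0: "0 \<le> B"
    and tail: "\<And>i. 1 \<le> i \<Longrightarrow> i \<le> L \<Longrightarrow>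
      (\<integral>x. (if B < \<bar>llr i x\<bar> then \<bar>llr i x\<bar> else 0) \<partial>density \<mu> (f i)) \<le> e"
    by auto

  define m where "m \<gamma> = nat \<lfloor>(1 - \<eta>) * K * ln \<gamma>\<rfloor>" for \<gamma> :: real
  have ln_top: "filterlim (ln :: real \<Rightarrow> real) at_top at_top" by (rule ln_at_top)
  have ev_top: "\<forall>\<^sub>F \<gamma> in at_top. y < ln (\<gamma> :: real)" for y
    using ln_top by (simp add: filterlim_at_top_dense)

  have lim_s: "((\<lambda>\<gamma>. \<Sum>i=1..h-1. d \<gamma> i * I i / ln \<gamma>) \<longlongrightarrow> s) at_top"
    unfolding s_def I_def using lim by (intro tendsto_sum) auto
  have lim_w: "((\<lambda>\<gamma>. \<Sum>i=1..h-1. d \<gamma> i / ln \<gamma>) \<longlongrightarrow> w) at_top"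
    unfolding w_def
  proof (intro tendsto_sum)
    fix i assume i: "i \<in> {1..h-1}"
    then have "1 \<le> i" "i \<le> L" "i < h" using h by auto
    then have "I i \<noteq> 0" using I[of i] by simp
    moreover have "((\<lambda>\<gamma>. d \<gamma> i * I i / ln \<gamma> / I i) \<longlongrightarrow> c i / I i) at_top"
      using lim[OF \<open>1 \<le> i\<close> \<open>i < h\<close>] \<open>I i \<noteq> 0\<close> unfolding I_def
      by (intro tendsto_divide tendsto_const)
    ultimately show "((\<lambda>\<gamma>. d \<gamma> i / ln \<gamma>) \<longlongrightarrow> c i / I i) at_top" by simp
  qed

  have ev_mean1: "\<forall>\<^sub>F \<gamma> in at_top. (\<Sum>i=1..h-1. d \<gamma> i * I i / ln \<gamma>) < 1 - 2 * \<kappa>"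
    using order_tendstoD(2)[OF lim_s \<kappa>s] .
  have ev_mean2: "\<forall>\<^sub>F \<gamma> in at_top. (\<Sum>i=1..h-1. d \<gamma> i * I i / ln \<gamma>)
      + ((1 - \<eta>) * K - (\<Sum>i=1..h-1. d \<gamma> i / ln \<gamma>)) * I h < 1 - 2 * \<kappa>"
  proof (rule order_tendstoD(2))
    \<comment> \<open>Here the value of \<open>K\<close> is used: it solves
      \<open>s + (K - w) * I h = 1\<close>.\<close>
    have "s + ((1 - \<eta>) * K - w) * I h = 1 - \<eta> * K * I h"
      using Ih by (simp add: K field_simps)
    moreover have "((\<lambda>\<gamma>. (\<Sum>i=1..h-1. d \<gamma> i * I i / ln \<gamma>)
      + ((1 - \<eta>) * K - (\<Sum>i=1..h-1. d \<gamma> i / ln \<gamma>)) * I h) \<longlongrightarrow> s + ((1 - \<eta>) * K - w) * I h) at_top"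
      by (intro tendsto_intros lim_s lim_w)
    ultimately show "((\<lambda>\<gamma>. (\<Sum>i=1..h-1. d \<gamma> i * I i / ln \<gamma>)
      + ((1 - \<eta>) * K - (\<Sum>i=1..h-1. d \<gamma> i / ln \<gamma>)) * I h) \<longlongrightarrow> 1 - \<eta> * K * I h) at_top" by simp
  qed (rule \<kappa>K)
  \<comment> \<open>The window is shorter than its critical length by \<open>\<eta> * K\<close>, in
    units of \<open>ln \<gamma>\<close>; half of this absorbs the error in the durations before
    \<open>h\<close>, half that in \<open>d \<gamma> h\<close>.\<close>
  have ev_window: "\<forall>\<^sub>F \<gamma> in at_top. h < L \<longrightarrow> (1 - \<eta>) * K \<le> (\<Sum>i=1..h. d \<gamma> i / ln \<gamma>)"
  proof (cases "h < L")
    case True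
    have "1 - s - \<eta> * K * I h / 2 < 1 - s" using \<eta> K0 Ih by simp
    then have "\<forall>\<^sub>F \<gamma> in at_top. 1 - s - \<eta> * K * I h / 2 \<le> d \<gamma> h * I h / ln \<gamma>"
      using lim_h[OF True] by (simp add: s_def I_def)
    moreover have "\<forall>\<^sub>F \<gamma> in at_top. w - \<eta> * K / 2 < (\<Sum>i=1..h-1. d \<gamma> i / ln \<gamma>)"
      using \<eta> K0 by (intro order_tendstoD(1)[OF lim_w]) simp
    ultimately show ?thesis
    proof eventually_elim
      case (elim \<gamma>)
      have "(1 - s) / I h - \<eta> * K / 2 \<le> d \<gamma> h / ln \<gamma>"
        using divide_right_mono[OF elim(1) less_imp_le[OF Ih]] Ih by (simp add: diff_divide_distrib)
      moreover have "(\<Sum>i=1..h. d \<gamma> i / ln \<gamma>) = (\<Sum>i=1..h-1. d \<gamma> i / ln \<gamma>) + d \<gamma> h / ln \<gamma>"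
        using h by (cases h) auto
      ultimately have "w + (1 - s) / I h - \<eta> * K \<le> (\<Sum>i=1..h. d \<gamma> i / ln \<gamma>)" using elim(2) by simp
      then show ?case unfolding K[symmetric] by (simp add: algebra_simps)
    qed
  qed simp
  have ev_exp: "\<forall>\<^sub>F \<gamma> in at_top. 2 * K * (ln \<gamma> * exp (- \<kappa> * ln \<gamma>)) < \<eta> / 2"
  proof (rule order_tendstoD(2))
    have "((\<lambda>x::real. x * exp (- \<kappa> * x)) \<longlongrightarrow> 0) at_top" using \<kappa>0 by real_asymp
    then have "((\<lambda>\<gamma>::real. ln \<gamma> * exp (- \<kappa> * ln \<gamma>)) \<longlongrightarrow> 0) at_top"
      using ln_top by (rule filterlim_compose)
    then show "((\<lambda>\<gamma>. 2 * K * (ln \<gamma> * exp (- \<kappa> * ln \<gamma>))) \<longlongrightarrow> 0) at_top"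
      by (rule tendsto_mult_right_zero)
  qed (use \<eta> in simp)

  show ?thesis
    \<comment> \<open>In order, the thresholds give \<open>ln \<gamma> > 0\<close>, a window length
      of at least 1, a Chebyshev term of at most \<open>\<eta> / 4\<close>, and rounding within its
      share of \<open>\<delta>\<close>.\<close>
    using ev_top[of 0] ev_top[of "1 / ((1 - \<eta>) * K)"] ev_top[of "16 * K * B\<^sup>2 / (\<kappa>\<^sup>2 * \<eta>)"]
      ev_top[of "3 / (K * \<delta>)"]
      ev_mean1 ev_mean2 ev_window ev_exp eventually_gt_at_top[of 1]
  proof eventually_elim
    case (elim \<gamma>)
    define x where "x = ln \<gamma>"
    have x0: "0 < x" using elim(1) by (simp add: x_def)
    have \<gamma>: "\<gamma> = exp x" "0 < \<gamma>" using elim(9) by (auto simp: x_def)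
    have a1: "1 < (1 - \<eta>) * K * x" using elim(2) \<eta> K0 by (simp add: x_def field_simps)
    have m_floor: "real (m \<gamma>) = of_int \<lfloor>(1 - \<eta>) * K * x\<rfloor>"
      using a1 by (simp add: m_def x_def)
    have m_le: "real (m \<gamma>) \<le> (1 - \<eta>) * K * x"
      unfolding m_floor by (rule of_int_floor_le)
    have m_ge: "(1 - \<eta>) * K * x - 1 \<le> real (m \<gamma>)"
      unfolding m_floor by (rule less_imp_le[OF real_of_int_floor_gt_diff_one])
    have m1: "1 \<le> m \<gamma>" using m_ge a1 by simp
    have "(1 - \<eta>) * (K * x) \<le> 1 * (K * x)"
      using \<eta> K0 x0 by (intro mult_right_mono) auto
    with m_le have m_leK: "real (m \<gamma>) \<le> K * x" by (simp only: mult.assoc mult_1)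
    have window: "m \<gamma> \<le> (\<Sum>i=1..h. d \<gamma> i)" if "h < L"
    proof -
      have "(1 - \<eta>) * K \<le> (\<Sum>i=1..h. real (d \<gamma> i)) / x"
        using elim(7) that by (simp add: sum_divide_distrib x_def)
      then have "(1 - \<eta>) * K * x \<le> (\<Sum>i=1..h. real (d \<gamma> i))"
        using x0 by (simp add: pos_le_divide_eq)
      then have "real (m \<gamma>) \<le> real (\<Sum>i=1..h. d \<gamma> i)" using m_le by simp
      then show ?thesis by (simp only: of_nat_le_iff)
    qed
    have mean: "(\<Sum>i=1..h-1. d \<gamma> i * I i) + real (m \<gamma> - (\<Sum>i=1..h-1. d \<gamma> i)) * I h \<le> (1 - 2 * \<kappa>) * x"
    proof -
      let ?A = "\<Sum>i=1..h-1. d \<gamma> i * I i" and ?D = "\<Sum>i=1..h-1. real (d \<gamma> i)"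
      have A1: "?A \<le> (1 - 2 * \<kappa>) * x"
        using elim(5) x0 by (simp add: sum_divide_distrib[symmetric] x_def[symmetric] pos_divide_less_eq)
      have "(?A / x + ((1 - \<eta>) * K - ?D / x) * I h) * x \<le> (1 - 2 * \<kappa>) * x"
        using elim(6) x0 by (intro mult_right_mono) (simp_all add: sum_divide_distrib[symmetric] x_def[symmetric])
      moreover have "(?A / x + ((1 - \<eta>) * K - ?D / x) * I h) * x = ?A + ((1 - \<eta>) * K * x - ?D) * I h"
        using x0 by (simp add: field_simps)
      ultimately have A2: "?A + ((1 - \<eta>) * K * x - ?D) * I h \<le> (1 - 2 * \<kappa>) * x" by simp
      \<comment> \<open>If the subtraction truncates to 0, \<open>A1\<close> gives the bound;
        otherwise \<open>A2\<close> does.\<close>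
      have "real (m \<gamma> - (\<Sum>i=1..h-1. d \<gamma> i)) = (if real (m \<gamma>) \<le> ?D then 0 else real (m \<gamma>) - ?D)"
        by (auto simp: of_nat_diff_if of_nat_sum[symmetric] simp del: of_nat_sum)
      moreover have "(real (m \<gamma>) - ?D) * I h \<le> ((1 - \<eta>) * K * x - ?D) * I h"
        using m_le Ih by (intro mult_right_mono) auto
      ultimately show ?thesis using A1 A2 by (auto split: if_splits)
    qed
    define p where "p = 4 * real (m \<gamma>) * B\<^sup>2 / (\<kappa> * x)\<^sup>2 + 4 * real (m \<gamma>) * e / (\<kappa> * x)"
    have dev: "measure (P (d \<gamma>) v) {\<omega>\<in>space Pinf. (1 - \<kappa>) * x < LLR (d \<gamma>) v (m \<gamma>) \<omega>} \<le> p" if v: "1 \<le> v" for v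
      unfolding p_def
    proof (rule LLR_deviation[OF _ v _ _ B0 tail])
      show "(\<Sum>k\<in>{v..<v + m \<gamma>}. KL_info \<mu> f (regime (d \<gamma>) v k)) + \<kappa> * x \<le> (1 - \<kappa>) * x"
        using sum_KL_info_regime_le[OF v h, of "m \<gamma>" "d \<gamma>"] window mean
        unfolding I_def by (simp add: algebra_simps)
    qed (use h \<kappa>0 x0 in auto)
    have p_le: "p \<le> \<eta> / 2"
    proof -
      have "4 * real (m \<gamma>) * B\<^sup>2 / (\<kappa> * x)\<^sup>2 \<le> 4 * (K * x) * B\<^sup>2 / (\<kappa> * x)\<^sup>2"
        using m_leK by (intro divide_right_mono mult_right_mono) auto
      also have "\<dots> = 4 * K * B\<^sup>2 / \<kappa>\<^sup>2 / x" using x0 \<kappa>0 by (simp add: field_simps power2_eq_square)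
      also have "\<dots> \<le> \<eta> / 4"
        using elim(3) x0 \<kappa>0 \<eta> by (simp add: x_def[symmetric] field_simps)
      finally have 1: "4 * real (m \<gamma>) * B\<^sup>2 / (\<kappa> * x)\<^sup>2 \<le> \<eta> / 4" .
      have "4 * real (m \<gamma>) * e / (\<kappa> * x) \<le> 4 * (K * x) * e / (\<kappa> * x)"
        using m_leK e0 \<kappa>0 x0 by (intro divide_right_mono mult_right_mono) auto
      also have "\<dots> = \<eta> / 4" using x0 \<kappa>0 K0 by (simp add: e_def field_simps)
      finally show ?thesis using 1 by (simp add: p_def)
    qed
    have "exp ((1 - \<kappa>) * x) * (2 * real (m \<gamma>) / \<gamma>) = 2 * real (m \<gamma>) * exp (- \<kappa> * x)"
      by (simp add: \<gamma>(1) algebra_simps exp_diff exp_minus field_simps)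
    also have "\<dots> \<le> 2 * (K * x) * exp (- \<kappa> * x)"
      using m_leK by (intro mult_right_mono) auto
    also have "\<dots> \<le> \<eta> / 2" using elim(8) by (simp add: x_def[symmetric] mult.assoc)
    finally have q: "exp ((1 - \<kappa>) * x) * (2 * real (m \<gamma>) / \<gamma>) + p \<le> \<eta>" using p_le by simp
    have "1 - \<delta> \<le> (1 - \<eta>) * (1 - \<eta>) - \<delta> / 3" unfolding \<eta>_def by (simp add: algebra_simps)
    then have "(1 - \<delta>) * (K * x) \<le> ((1 - \<eta>) * (1 - \<eta>) - \<delta> / 3) * (K * x)"
      using K0 x0 by (intro mult_right_mono) auto
    also have "\<dots> = (1 - \<eta>) * K * x * (1 - \<eta>) - K * \<delta> * x / 3" by (simp add: algebra_simps)
    also have "\<dots> \<le> (1 - \<eta>) * K * x * (1 - \<eta>) - (1 - \<eta>)"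
    proof -
      have "1 \<le> K * \<delta> * x / 3" using elim(4) K0 \<delta> by (simp add: x_def[symmetric] field_simps)
      then show ?thesis using \<eta> by linarith
    qed
    also have "\<dots> = ((1 - \<eta>) * K * x - 1) * (1 - \<eta>)" by (simp add: algebra_simps)
    also have "\<dots> \<le> m \<gamma> * (1 - \<eta>)"
      using m_ge \<eta> by (intro mult_right_mono) auto
    also have "\<dots> \<le> m \<gamma> * (1 - (exp ((1 - \<kappa>) * x) * (2 * real (m \<gamma>) / \<gamma>) + p))"
      using q by (intro mult_left_mono) auto
    finally have final: "(1 - \<delta>) * (K * x) \<le> m \<gamma> * (1 - (exp ((1 - \<kappa>) * x) * (2 * real (m \<gamma>) / \<gamma>) + p))" .
    show ?case
    proof
      fix \<tau> assume \<tau>: "\<tau> \<in> stopping_class \<mu> X Pinf \<gamma>"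
      have "ennreal ((1 - \<delta>) * (K * ln \<gamma>)) \<le> ennreal (m \<gamma> * (1 - (exp ((1 - \<kappa>) * x) * (2 * real (m \<gamma>) / \<gamma>) + p)))"
        using final by (simp add: x_def ennreal_leI)
      also have "\<dots> \<le> pollak_delay (P (d \<gamma>)) \<tau>"
        using h by (intro pollak_delay_ge[OF _ \<tau> \<gamma>(2) m1 dev]) auto
      finally show "ennreal ((1 - \<delta>) * (K * ln \<gamma>)) \<le> pollak_delay (P (d \<gamma>)) \<tau>" .
    qed
  qed
qed

end

text \<open>Eventual bounds for each fixed \<open>\<delta>\<close> are merged into a single error
  function: once the bound for \<open>\<delta>\<close> holds, the error is at most
  \<open>\<delta>\<close>. For every \<open>\<gamma> > 1\<close> the inequality holds by the choice
  of the error.\<close>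

lemma ennreal_lower_bound_asymptotic:
  fixes R :: "real \<Rightarrow> ennreal" and K :: real
  assumes K: "0 < K"
    and ev: "\<And>\<delta>. 0 < \<delta> \<Longrightarrow> \<delta> < 1 \<Longrightarrow> \<forall>\<^sub>F \<gamma> in at_top. ennreal ((1 - \<delta>) * (K * ln \<gamma>)) \<le> R \<gamma>"
  shows "\<exists>\<epsilon> :: real \<Rightarrow> real. \<epsilon> \<in> o[at_top](\<lambda>_. 1) \<and>
    (\<forall>\<gamma>>1. ennreal (ln \<gamma>) * ennreal K * ennreal (1 - \<epsilon> \<gamma>) \<le> R \<gamma>)"
proof -
  txt \<open>The smallest nonnegative \<open>\<epsilon>\<close> for which the bound holds.\<close>
  define \<epsilon> where "\<epsilon> \<gamma> = (if R \<gamma> = top then 0 else max 0 (1 - enn2real (R \<gamma>) / (K * ln \<gamma>)))" for \<gamma>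
  have "(\<epsilon> \<longlongrightarrow> 0) at_top"
  proof (rule order_tendstoI)
    fix a :: real assume "0 < a"
    define \<delta> where "\<delta> = min (a / 2) (1 / 2)"
    have \<delta>: "0 < \<delta>" "\<delta> < 1" "\<delta> < a" using \<open>0 < a\<close> by (auto simp: \<delta>_def)
    show "\<forall>\<^sub>F \<gamma> in at_top. \<epsilon> \<gamma> < a"
      using ev[OF \<delta>(1,2)] eventually_gt_at_top[of 1]
    proof eventually_elim
      case (elim \<gamma>)
      show ?case
      proof (cases "R \<gamma> = top")
        case False
        have Kl: "0 < K * ln \<gamma>" using K elim(2) by simp
        have "(1 - \<delta>) * (K * ln \<gamma>) \<le> enn2real (R \<gamma>)"
          using enn2real_mono[OF elim(1)] False Kl \<delta> by (simp add: less_top)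
        then have "1 - \<delta> \<le> enn2real (R \<gamma>) / (K * ln \<gamma>)" using Kl by (simp add: pos_le_divide_eq)
        then show ?thesis using \<delta> by (simp add: \<epsilon>_def)
      qed (use \<open>0 < a\<close> in \<open>simp add: \<epsilon>_def\<close>)
    qed
  qed (auto simp: \<epsilon>_def intro!: always_eventually)
  then have "\<epsilon> \<in> o[at_top](\<lambda>_. 1)" by (intro smalloI_tendsto) auto
  moreover have "ennreal (ln \<gamma>) * ennreal K * ennreal (1 - \<epsilon> \<gamma>) \<le> R \<gamma>" if "1 < \<gamma>" for \<gamma>
  proof (cases "R \<gamma> = top")
    case False
    have Kl: "0 < K * ln \<gamma>" "0 < ln \<gamma>" using K that by simp_all
    have "1 - \<epsilon> \<gamma> \<le> enn2real (R \<gamma>) / (K * ln \<gamma>)" using False by (simp add: \<epsilon>_def)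
    then have "(K * ln \<gamma>) * (1 - \<epsilon> \<gamma>) \<le> enn2real (R \<gamma>)" using Kl by (simp only: pos_le_divide_eq mult.commute)
    then have "ennreal ((K * ln \<gamma>) * (1 - \<epsilon> \<gamma>)) \<le> R \<gamma>"
      using False by (metis ennreal_enn2real ennreal_leI less_top)
    moreover have "ennreal (ln \<gamma>) * ennreal K * ennreal (1 - \<epsilon> \<gamma>) = ennreal ((K * ln \<gamma>) * (1 - \<epsilon> \<gamma>))"
      using Kl K by (simp add: ennreal_mult' mult.commute[of "ennreal (ln \<gamma>)"])
    ultimately show ?thesis by simp
  qed simp
  ultimately show ?thesis by blast
qed

theorem theorem5:
  fixes L :: nat and \<mu> :: "'a measure" and f :: "nat \<Rightarrow> 'a \<Rightarrow> real"
    and X :: "nat \<Rightarrow> 'w \<Rightarrow> 'a" and Pinf :: "'w measure"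
    and P :: "(nat \<Rightarrow> nat) \<Rightarrow> nat \<Rightarrow> 'w measure"
    and d :: "real \<Rightarrow> nat \<Rightarrow> nat" and c :: "nat \<Rightarrow> ennreal" and h :: nat
  assumes model: "transient_change_model L \<mu> f X Pinf P"
    and L: "2 \<le> L"
    and d_at_top: "\<And>i. 1 \<le> i \<Longrightarrow> i \<le> L - 1 \<Longrightarrow> filterlim (\<lambda>\<gamma>. d \<gamma> i) at_top at_top"
    and d_asymp: "\<And>i. 1 \<le> i \<Longrightarrow> i \<le> L - 1 \<Longrightarrow>
          ((\<lambda>\<gamma>. ennreal (real (d \<gamma> i) * KL_info \<mu> f i / ln \<gamma>)) \<longlongrightarrow> c i) at_top"
    and c_L: "c L = \<infinity>"
    and h: "h = (LEAST j. 1 \<le> j \<and> j \<le> L \<and> 1 \<le> (\<Sum>i=1..j. c i))"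
  shows "\<exists>\<epsilon> :: real \<Rightarrow> real. \<epsilon> \<in> o[at_top](\<lambda>_. 1) \<and>
    (\<forall>\<gamma>>1.
       (INF \<tau>\<in>stopping_class \<mu> X Pinf \<gamma>. pollak_delay (P (d \<gamma>)) \<tau>)
         \<le> (INF \<tau>\<in>stopping_class \<mu> X Pinf \<gamma>. lorden_delay \<mu> X (P (d \<gamma>)) \<tau>) \<and>
       ennreal (ln \<gamma>)
         * ((\<Sum>i=1..h - 1. c i / ennreal (KL_info \<mu> f i))
            + (1 - (\<Sum>i=1..h - 1. c i)) / ennreal (KL_info \<mu> f h))
         * ennreal (1 - \<epsilon> \<gamma>)
         \<le> (INF \<tau>\<in>stopping_class \<mu> X Pinf \<gamma>. pollak_delay (P (d \<gamma>)) \<tau>))"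
proof -
  interpret transient_change_model L \<mu> f X Pinf P by (rule model)
  let ?I = "KL_info \<mu> f"
  have hP: "1 \<le> h \<and> h \<le> L \<and> 1 \<le> (\<Sum>i=1..h. c i)"
    unfolding h
  proof (rule LeastI)
    have "c L \<le> (\<Sum>i=1..L. c i)" using L by (intro member_le_sum) auto
    moreover have "1 \<le> c L" using c_L by simp
    ultimately show "1 \<le> L \<and> L \<le> L \<and> 1 \<le> (\<Sum>i=1..L. c i)" using L by (auto intro: order_trans)
  qed
  then have h1: "1 \<le> h" and hL: "h \<le> L" by auto
  \<comment> \<open>Minimality of \<open>h\<close>; for \<open>h = 1\<close> the sum is
    empty.\<close>
  have s_less: "(\<Sum>i=1..h-1. c i) < 1"
  proof (cases "h = 1")
    case False
    then have "\<not> (1 \<le> h - 1 \<and> h - 1 \<le> L \<and> 1 \<le> (\<Sum>i=1..h-1. c i))"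
      unfolding h by (intro not_less_Least) (use h h1 in simp)
    then show ?thesis using False h1 hL by auto
  qed simp
  \<comment> \<open>For \<open>i < h\<close> the constants are finite, being bounded by a sum below
    1, so the conversion loses nothing there.\<close>
  define c' where "c' i = enn2real (c i)" for i
  have c_eq: "c i = ennreal (c' i)" if "i \<in> {1..h-1}" for i
  proof -
    have "c i \<le> (\<Sum>i=1..h-1. c i)" using that by (intro member_le_sum) auto
    then have "c i < top" using s_less by (meson ennreal_one_less_top less_trans le_less_trans)
    then show ?thesis by (simp add: c'_def)
  qed
  have c'0: "0 \<le> c' i" for i by (simp add: c'_def)
  have s_eq: "(\<Sum>i=1..h-1. c i) = ennreal (\<Sum>i=1..h-1. c' i)"
    using c_eq c'0 by (subst sum_ennreal[symmetric]) auto
  have s'_less: "(\<Sum>i=1..h-1. c' i) < 1"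
    using s_less unfolding s_eq by (simp add: ennreal_less_one_iff)
  have s'0: "0 \<le> (\<Sum>i=1..h-1. c' i)" using c'0 by (simp add: sum_nonneg)
  have I0: "0 < ?I i" if "1 \<le> i" "i \<le> L" for i using KL_pos[OF that] .
  define K where "K = (\<Sum>i=1..h-1. c' i / ?I i) + (1 - (\<Sum>i=1..h-1. c' i)) / ?I h"
  have sumI0: "0 \<le> (\<Sum>i=1..h-1. c' i / ?I i)"
    using c'0 I0 hL by (intro sum_nonneg divide_nonneg_pos) auto
  have K0: "0 < K"
    unfolding K_def using s'_less I0[OF h1 hL] sumI0 by (intro add_nonneg_pos divide_pos_pos) auto
  have K_eq: "(\<Sum>i=1..h-1. c i / ennreal (?I i)) + (1 - (\<Sum>i=1..h-1. c i)) / ennreal (?I h) = ennreal K"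
  proof -
    have "(\<Sum>i=1..h-1. c i / ennreal (?I i)) = (\<Sum>i=1..h-1. ennreal (c' i / ?I i))"
      using c_eq c'0 I0 hL by (intro sum.cong) (auto simp: divide_ennreal)
    also have "\<dots> = ennreal (\<Sum>i=1..h-1. c' i / ?I i)"
      using c'0 I0 hL by (intro sum_ennreal divide_nonneg_pos) auto
    finally have 1: "(\<Sum>i=1..h-1. c i / ennreal (?I i)) = ennreal (\<Sum>i=1..h-1. c' i / ?I i)" .
    have "1 - (\<Sum>i=1..h-1. c i) = ennreal (1 - (\<Sum>i=1..h-1. c' i))"
      unfolding s_eq using s'0 by (simp add: ennreal_minus[symmetric])
    then have "(1 - (\<Sum>i=1..h-1. c i)) / ennreal (?I h) = ennreal ((1 - (\<Sum>i=1..h-1. c' i)) / ?I h)"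
      using s'_less I0[OF h1 hL] by (simp add: divide_ennreal)
    then show ?thesis
      using sumI0 s'_less I0[OF h1 hL] unfolding 1 K_def by (simp add: ennreal_plus)
  qed
  have d_nonneg: "\<forall>\<^sub>F \<gamma> in at_top. 0 \<le> d \<gamma> i * ?I i / ln \<gamma>" if "1 \<le> i" "i \<le> L" for i
    using eventually_gt_at_top[of 1] by eventually_elim (use I0[OF that] in simp)
  have lim: "((\<lambda>\<gamma>. d \<gamma> i * ?I i / ln \<gamma>) \<longlongrightarrow> c' i) at_top" if "1 \<le> i" "i < h" for i
    using d_asymp[of i] that hL c'0 c_eq[of i] d_nonneg[of i] by (intro tendsto_ennrealD) auto
  have lim_h: "\<forall>\<^sub>F \<gamma> in at_top. y \<le> d \<gamma> h * ?I h / ln \<gamma>"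
    if hL': "h < L" and y: "y < 1 - (\<Sum>i=1..h-1. c' i)" for y
  proof -
    \<comment> \<open>This is the other half of the choice of \<open>h\<close>: the partial sum up
      to \<open>h\<close> is at least 1. Working in \<open>ennreal\<close> includes the case of an
      infinite \<open>c h\<close>.\<close>
    have "ennreal (1 - (\<Sum>i=1..h-1. c' i)) \<le> c h"
    proof -
      have "(\<Sum>i=1..h. c i) = ennreal (\<Sum>i=1..h-1. c' i) + c h"
        using h1 s_eq by (cases h) auto
      then have "1 \<le> ennreal (\<Sum>i=1..h-1. c' i) + c h" using hP by simp
      then have "1 - ennreal (\<Sum>i=1..h-1. c' i) \<le> c h" by (simp add: ennreal_minus_le_iff)
      then show ?thesis using s'0 by (simp add: ennreal_minus[symmetric])
    qed
    moreover have "ennreal y < ennreal (1 - (\<Sum>i=1..h-1. c' i))"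
      using y s'_less by (simp add: ennreal_less_iff ennreal_lessI)
    ultimately have "ennreal y < c h" by simp
    moreover have "((\<lambda>\<gamma>. ennreal (d \<gamma> h * ?I h / ln \<gamma>)) \<longlongrightarrow> c h) at_top"
      using d_asymp[of h] h1 hL' by simp
    ultimately have "\<forall>\<^sub>F \<gamma> in at_top. ennreal y < ennreal (d \<gamma> h * ?I h / ln \<gamma>)"
      by (intro order_tendstoD(1))
    then show ?thesis
      using d_nonneg[OF h1 hL] by eventually_elim (metis ennreal_leI not_le linear)
  qed
  have "\<exists>\<epsilon> :: real \<Rightarrow> real. \<epsilon> \<in> o[at_top](\<lambda>_. 1) \<and>
    (\<forall>\<gamma>>1. ennreal (ln \<gamma>) * ennreal K * ennreal (1 - \<epsilon> \<gamma>) \<le>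
      (INF \<tau>\<in>stopping_class \<mu> X Pinf \<gamma>. pollak_delay (P (d \<gamma>)) \<tau>))"
  proof (rule ennreal_lower_bound_asymptotic[OF K0])
    fix \<delta> :: real assume "0 < \<delta>" "\<delta> < 1"
    then have "\<forall>\<^sub>F \<gamma> in at_top. \<forall>\<tau>\<in>stopping_class \<mu> X Pinf \<gamma>.
      ennreal ((1 - \<delta>) * (K * ln \<gamma>)) \<le> pollak_delay (P (d \<gamma>)) \<tau>"
      unfolding K_def by (intro eventually_pollak_delay_ge[OF h1 hL lim c'0 s'_less lim_h])
    then show "\<forall>\<^sub>F \<gamma> in at_top. ennreal ((1 - \<delta>) * (K * ln \<gamma>)) \<le>
      (INF \<tau>\<in>stopping_class \<mu> X Pinf \<gamma>. pollak_delay (P (d \<gamma>)) \<tau>)"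
      by eventually_elim (auto intro: INF_greatest)
  qed
  moreover have "(INF \<tau>\<in>stopping_class \<mu> X Pinf \<gamma>. pollak_delay (P (d \<gamma>)) \<tau>)
    \<le> (INF \<tau>\<in>stopping_class \<mu> X Pinf \<gamma>. lorden_delay \<mu> X (P (d \<gamma>)) \<tau>)" for \<gamma>
    using pollak_delay_le_lorden_delay by (intro INF_mono) blast
  ultimately show ?thesis unfolding K_eq by blast
qed

end
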